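(* Let $I$ be a compact interval in $\mathbb{R}$ with coordinate $s$, and let $\phi_0:I\to S^6$ and $\psi_0:I\to\mathbb{R}^7$ be real analytic maps (real analytic on an open set containing $I$). Then there exist $\epsilon>0$ and unique real analytic maps $\phi:I\times(-\epsilon,\epsilon)\to S^6$ and $\psi:I\times(-\epsilon,\epsilon)\to\mathbb{R}^7$ with $\phi(s,0)=\phi_0(s)$, $\psi(s,0)=\psi_0(s)$ for all $s\in I$ and $$\frac{\partial\phi}{\partial t}=\phi\times\frac{\partial\phi}{\partial s},\qquad \frac{\partial\psi}{\partial t}=\phi\times\frac{\partial\psi}{\partial s},$$ where $t$ is the coordinate on $(-\epsilon,\epsilon)$. Moreover $M=\{r\phi(s,t)+\psi(s,t):r\in\mathbb{R},s\in I,t\in(-\epsilon,\epsilon)\}$ is an r-oriented ruled associative 3-fold in $\mathbb{R}^7$.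
   Context: Let $(x_1,\dots,x_7)$ be coordinates on $\mathbb{R}^7$ with Euclidean metric $g$, $dx_{ijk}=dx_i\wedge dx_j\wedge dx_k$, and $\varphi=dx_{123}+dx_{145}+dx_{167}+dx_{246}-dx_{257}-dx_{347}-dx_{356}$. The cross product $\times$ on $\mathbb{R}^7$ is defined by $g(u\times v,w)=\varphi(u,v,w)$. An oriented 3-dimensional (immersed) submanifold $N$ is associative if $\varphi|_{T_xN}=\mathrm{vol}_{T_xN}$ for all $x\in N$. A 3-dimensional submanifold written as $\{r\phi(\sigma)+\psi(\sigma)\}$ with $\phi$ valued in $S^6$ is r-oriented ruled: it is a union of affine lines $\{r\phi(\sigma)+\psi(\sigma):r\in\mathbb{R}\}$ parametrised by $\sigma$, each oriented by the unit direction $\phi(\sigma)$, this orientation varying smoothly.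
   Formalization: That M is a 3-fold is not claimed, since it fails e.g. for constant φ0, ψ0 (M is then a line); M is shown to be ruled by oriented lines and associative wherever (r,s,t) ↦ rφ+ψ is an immersion; I is taken with more than one point. *)

theory Defs
  imports "HOL-Analysis.Analysis"
begin

text \<open>Vectors of R^7 are elements of real^7; the paper's coordinate x_k (k = 1..7)
  is the component at index of_nat (k - 1) of the numeral type 7.\<close>

definition coord :: "real^7 \<Rightarrow> nat \<Rightarrow> real" where
  "coord x k = x $ (of_nat (k - 1) :: 7)"

text \<open>dx_i /\ dx_j /\ dx_k evaluated on (u, v, w): a 3x3 determinant.\<close>
definition dx3 :: "nat \<Rightarrow> nat \<Rightarrow> nat \<Rightarrow> real^7 \<Rightarrow> real^7 \<Rightarrow> real^7 \<Rightarrow> real" where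
  "dx3 i j k u v w =
      coord u i * (coord v j * coord w k - coord v k * coord w j)
    - coord u j * (coord v i * coord w k - coord v k * coord w i)
    + coord u k * (coord v i * coord w j - coord v j * coord w i)"

text \<open>The G2 3-form phi = dx123 + dx145 + dx167 + dx246 - dx257 - dx347 - dx356.\<close>
definition phi7 :: "real^7 \<Rightarrow> real^7 \<Rightarrow> real^7 \<Rightarrow> real" where
  "phi7 u v w = dx3 1 2 3 u v w + dx3 1 4 5 u v w + dx3 1 6 7 u v w + dx3 2 4 6 u v w
              - dx3 2 5 7 u v w - dx3 3 4 7 u v w - dx3 3 5 6 u v w"

text \<open>Cross product: g(u \<times> v, w) = phi(u, v, w); the i-th component of u \<times> v is
  phi(u, v, e_i).\<close>
definition cross7 :: "real^7 \<Rightarrow> real^7 \<Rightarrow> real^7" where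
  "cross7 u v = (\<chi> i. phi7 u v (axis i 1))"

text \<open>Volume of the parallelepiped spanned by u, v, w: square root of the Gram determinant.\<close>
definition vol3 :: "real^7 \<Rightarrow> real^7 \<Rightarrow> real^7 \<Rightarrow> real" where
  "vol3 u v w =
     (let a = u \<bullet> u; b = u \<bullet> v; c = u \<bullet> w; d = v \<bullet> v; e = v \<bullet> w; f = w \<bullet> w
      in sqrt (a * (d * f - e * e) - b * (b * f - e * c) + c * (b * e - d * c)))"

definition real_analytic1_on :: "(real \<Rightarrow> real^7) \<Rightarrow> real set \<Rightarrow> bool" where
  "real_analytic1_on f U \<longleftrightarrow>
     (\<forall>x0\<in>U. \<exists>r>0. \<exists>c :: nat \<Rightarrow> real^7.
        \<forall>x. \<bar>x - x0\<bar> < r \<longrightarrow> (\<lambda>n. (x - x0) ^ n *\<^sub>R c n) sums f x)"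

definition real_analytic2_on :: "(real \<Rightarrow> real \<Rightarrow> real^7) \<Rightarrow> (real \<times> real) set \<Rightarrow> bool" where
  "real_analytic2_on f U \<longleftrightarrow>
     (\<forall>(s0, t0)\<in>U. \<exists>r>0. \<exists>c :: nat \<Rightarrow> nat \<Rightarrow> real^7.
        \<forall>s t. dist (s, t) (s0, t0) < r \<longrightarrow>
          ((\<lambda>(m, n). ((s - s0) ^ m * (t - t0) ^ n) *\<^sub>R c m n) has_sum f s t) UNIV)"

definition d_s :: "(real \<Rightarrow> real \<Rightarrow> real^7) \<Rightarrow> real \<Rightarrow> real \<Rightarrow> real^7" where
  "d_s f s t = vector_derivative (\<lambda>s'. f s' t) (at s)"

definition d_t :: "(real \<Rightarrow> real \<Rightarrow> real^7) \<Rightarrow> real \<Rightarrow> real \<Rightarrow> real^7" where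
  "d_t f s t = vector_derivative (\<lambda>t'. f s t') (at t)"

text \<open>The 3-fold M = {r phi(s,t) + psi(s,t)} with (s,t) in D, parametrised by
  F(r,s,t) = r phi(s,t) + psi(s,t), is r-oriented ruled (phi takes values in S^6,
  each line oriented by phi) and associative: at every point the oriented tangent
  frame (F_r, F_s, F_t) satisfies phi(F_r,F_s,F_t) = vol(F_r,F_s,F_t), i.e.
  phi restricted to the oriented tangent 3-plane is its volume form
  (wherever F is an immersion; at non-immersed points both sides vanish).\<close>
definition ruled_associative ::
    "(real \<Rightarrow> real \<Rightarrow> real^7) \<Rightarrow> (real \<Rightarrow> real \<Rightarrow> real^7) \<Rightarrow> (real \<times> real) set \<Rightarrow> bool" where
  "ruled_associative phi psi D \<longleftrightarrow>
     (\<forall>(s, t)\<in>D. norm (phi s t) = 1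
        \<and> (\<lambda>s'. phi s' t) differentiable (at s) \<and> (\<lambda>t'. phi s t') differentiable (at t)
        \<and> (\<lambda>s'. psi s' t) differentiable (at s) \<and> (\<lambda>t'. psi s t') differentiable (at t)
        \<and> (\<forall>r::real.
             let Fr = phi s t;
                 Fs = r *\<^sub>R d_s phi s t + d_s psi s t;
                 Ft = r *\<^sub>R d_t phi s t + d_t psi s t
             in phi7 Fr Fs Ft = vol3 Fr Fs Ft))"

end

theory Submission
  imports Defs
    "HOL-Complex_Analysis.Cauchy_Integral_Formula"
    "HOL-Computational_Algebra.Formal_Power_Series"
begin

text \<open>
  Both equations are one quadratic equation \<open>w\<^sub>t = B(w, w\<^sub>s)\<close> for \<open>w = (\<phi>, \<psi>)\<close>, with the bounded
  bilinear map \<open>B((u, v), (u', v')) = (u \<times> u', u \<times> v')\<close>. Expanding \<open>w = \<Sum> t\<^sup>n a\<^sub>n(s)\<close>, the equation is equivalent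
  to \<open>a\<^sub>0 = w(\<cdot>, 0)\<close> and \<open>(n + 1) a\<^sub>n\<^sub>+\<^sub>1 = \<Sum> B(a\<^sub>k, a\<^sub>n\<^sub>-\<^sub>k')\<close>. The functions \<open>a\<^sub>n\<close> are thus defined on
  the whole interval, so that no local solutions have to be glued; a majorant argument at each \<open>s\<close> and compactness
  give a common radius of convergence in \<open>t\<close>. The same recursion gives uniqueness near \<open>t = 0\<close> over the
  open interval, which spreads in \<open>t\<close> by the identity theorem and to the end points by continuity.
  Since \<open>u \<times> v\<close> is orthogonal to \<open>u\<close> and \<open>v\<close> and
  \<open>\<bar>u \<times> v\<bar>\<^sup>2 = \<bar>u\<bar>\<^sup>2 \<bar>v\<bar>\<^sup>2 - (u \<bullet> v)\<^sup>2\<close>, the flow preserves \<open>\<bar>\<phi>\<bar> = 1\<close>, and with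
  \<open>v = r \<phi>\<^sub>s + \<psi>\<^sub>s\<close> the tangent frame \<open>(\<phi>, v, \<phi> \<times> v)\<close> is calibrated.
\<close>

section \<open>Vector-valued power series in one variable\<close>

lemma has_sum_sum_family:
  fixes f :: "'j \<Rightarrow> 'i \<Rightarrow> 'a::topological_comm_monoid_add"
  assumes "\<And>j. j \<in> J \<Longrightarrow> (f j has_sum S j) A"
  shows "((\<lambda>i. \<Sum>j\<in>J. f j i) has_sum (\<Sum>j\<in>J. S j)) A"
  using assms
  by (induction J rule: infinite_finite_induct) (auto intro!: has_sum_add)

text \<open>Each coordinate is a real family, for which unordered summability is absolute, and the
  norm is at most the sum of the absolute coordinates.\<close>

lemma summable_on_euclidean_iff_abs:
  fixes f :: "'i \<Rightarrow> 'a::euclidean_space"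
  shows "f summable_on A \<longleftrightarrow> (\<lambda>x. norm (f x)) summable_on A"
proof
  assume f: "f summable_on A"
  have "(\<lambda>x. \<Sum>b\<in>Basis. \<bar>f x \<bullet> b\<bar>) summable_on A"
  proof (rule has_sum_imp_summable[OF has_sum_sum_family[where S = "\<lambda>b. \<Sum>\<^sub>\<infinity>x\<in>A. \<bar>f x \<bullet> b\<bar>"]])
    fix b :: 'a assume "b \<in> Basis"
    have "(\<lambda>x. f x \<bullet> b) summable_on A"
      by (rule summable_on_bounded_linear[OF bounded_linear_inner_left f])
    then show "((\<lambda>x. \<bar>f x \<bullet> b\<bar>) has_sum (\<Sum>\<^sub>\<infinity>x\<in>A. \<bar>f x \<bullet> b\<bar>)) A"
      using summable_on_iff_abs_summable_on_real[of "\<lambda>x. f x \<bullet> b"] by simp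
  qed
  then have "(\<lambda>x. norm (\<Sum>b\<in>Basis. \<bar>f x \<bullet> b\<bar>)) summable_on A"
    by (rule summable_on_iff_abs_summable_on_real[THEN iffD1])
  then show "(\<lambda>x. norm (f x)) summable_on A"
    by (rule Infinite_Sum.abs_summable_on_comparison_test)
       (metis norm_le_l1 abs_ge_self order.trans real_norm_def)
qed (rule abs_summable_summable)

text \<open>Unordered sums turn interchanges of summation and Cauchy products into reindexings.
  Nothing is lost: inside its interval of convergence a power series converges absolutely, see
  \<open>power_series_on_iff_sums\<close>.\<close>

definition power_series_on :: "(real \<Rightarrow> 'a::euclidean_space) \<Rightarrow> real \<Rightarrow> (nat \<Rightarrow> 'a) \<Rightarrow> real \<Rightarrow> bool" where
  "power_series_on f x0 c r \<longleftrightarrow>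
     (\<forall>x. \<bar>x - x0\<bar> < r \<longrightarrow> ((\<lambda>n. (x - x0) ^ n *\<^sub>R c n) has_sum f x) UNIV)"

lemma power_series_onD:
  "power_series_on f x0 c r \<Longrightarrow> \<bar>x - x0\<bar> < r \<Longrightarrow> ((\<lambda>n. (x - x0) ^ n *\<^sub>R c n) has_sum f x) UNIV"
  by (simp add: power_series_on_def)

lemma power_series_on_mono: "power_series_on f x0 c r \<Longrightarrow> r' \<le> r \<Longrightarrow> power_series_on f x0 c r'"
  by (auto simp: power_series_on_def)

lemma power_series_on_cong:
  "power_series_on f x0 c r \<Longrightarrow> (\<And>x. \<bar>x - x0\<bar> < r \<Longrightarrow> f x = g x) \<Longrightarrow> power_series_on g x0 c r"
  by (auto simp: power_series_on_def)

text \<open>The reduction to scalar series gives access to termwise differentiation and to the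
  isolation of zeros. For the converse, ordered convergence on the whole interval forces absolute
  convergence in each coordinate.\<close>

lemma power_series_on_iff_components:
  "power_series_on f x0 c r \<longleftrightarrow>
     (\<forall>b\<in>Basis. \<forall>x. \<bar>x - x0\<bar> < r \<longrightarrow> (\<lambda>n. (c n \<bullet> b) * (x - x0) ^ n) sums (f x \<bullet> b))"
proof (intro iffI ballI allI impI)
  fix b :: 'a and x assume "power_series_on f x0 c r" "b \<in> Basis" "\<bar>x - x0\<bar> < r"
  then have "((\<lambda>n. (x - x0) ^ n *\<^sub>R c n) has_sum f x) UNIV"
    by (simp add: power_series_on_def)
  from has_sum_imp_sums[OF has_sum_bounded_linear[OF bounded_linear_inner_left[of b] this]]
  show "(\<lambda>n. (c n \<bullet> b) * (x - x0) ^ n) sums (f x \<bullet> b)"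
    by (simp add: mult.commute)
next
  assume R: "\<forall>b\<in>Basis. \<forall>x. \<bar>x - x0\<bar> < r \<longrightarrow> (\<lambda>n. (c n \<bullet> b) * (x - x0) ^ n) sums (f x \<bullet> b)"
  show "power_series_on f x0 c r"
    unfolding power_series_on_def
  proof (intro allI impI)
    fix x assume x: "\<bar>x - x0\<bar> < r"
    have "((\<lambda>n. \<Sum>b\<in>Basis. ((x - x0) ^ n * (c n \<bullet> b)) *\<^sub>R b) has_sum (\<Sum>b\<in>Basis. (f x \<bullet> b) *\<^sub>R b)) UNIV"
    proof (rule has_sum_sum_family)
      fix b :: 'a assume b: "b \<in> Basis"
      \<comment> \<open>The point \<open>y\<close> is farther from \<open>x0\<close> than
        \<open>x\<close> but still within \<open>r\<close>; convergence at \<open>y\<close> makes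
        the series at \<open>x\<close> absolutely convergent.\<close>
      define y where "y = x0 + (\<bar>x - x0\<bar> + r) / 2"
      have y: "\<bar>y - x0\<bar> < r" "norm (x - x0) < norm (y - x0)"
        using x by (auto simp: y_def abs_if field_simps)
      have "summable (\<lambda>n. (c n \<bullet> b) * (y - x0) ^ n)"
        using R b y by (blast intro: sums_summable)
      from powser_insidea[OF this y(2)] have "summable (\<lambda>n. norm ((c n \<bullet> b) * (x - x0) ^ n))" .
      moreover have "(\<lambda>n. (c n \<bullet> b) * (x - x0) ^ n) sums (f x \<bullet> b)" using R b x by blast
      ultimately have "((\<lambda>n. (c n \<bullet> b) * (x - x0) ^ n) has_sum (f x \<bullet> b)) UNIV"
        by (rule norm_summable_imp_has_sum)
      from has_sum_bounded_linear[OF bounded_linear_scaleR_left[of b] this]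
      show "((\<lambda>n. ((x - x0) ^ n * (c n \<bullet> b)) *\<^sub>R b) has_sum (f x \<bullet> b) *\<^sub>R b) UNIV"
        by (simp add: mult.commute)
    qed
    moreover have "(\<Sum>b\<in>Basis. ((x - x0) ^ n * (c n \<bullet> b)) *\<^sub>R b) = (x - x0) ^ n *\<^sub>R c n" for n
      using euclidean_representation[of "(x - x0) ^ n *\<^sub>R c n"] by simp
    ultimately show "((\<lambda>n. (x - x0) ^ n *\<^sub>R c n) has_sum f x) UNIV"
      by (simp add: euclidean_representation)
  qed
qed

lemma power_series_on_iff_sums:
  "power_series_on f x0 c r \<longleftrightarrow> (\<forall>x. \<bar>x - x0\<bar> < r \<longrightarrow> (\<lambda>n. (x - x0) ^ n *\<^sub>R c n) sums f x)"
proof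
  assume "power_series_on f x0 c r"
  then show "\<forall>x. \<bar>x - x0\<bar> < r \<longrightarrow> (\<lambda>n. (x - x0) ^ n *\<^sub>R c n) sums f x"
    by (auto simp: power_series_on_def intro: has_sum_imp_sums)
next
  assume R: "\<forall>x. \<bar>x - x0\<bar> < r \<longrightarrow> (\<lambda>n. (x - x0) ^ n *\<^sub>R c n) sums f x"
  show "power_series_on f x0 c r"
    unfolding power_series_on_iff_components
  proof (intro ballI allI impI)
    fix b :: 'a and x assume "\<bar>x - x0\<bar> < r"
    then have "(\<lambda>n. (x - x0) ^ n *\<^sub>R c n) sums f x" using R by blast
    from bounded_linear.sums[OF bounded_linear_inner_left[of b] this]
    show "(\<lambda>n. (c n \<bullet> b) * (x - x0) ^ n) sums (f x \<bullet> b)" by (simp add: mult.commute)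
  qed
qed

text \<open>The terms of a convergent series are bounded; at the point \<open>x0 + \<rho>\<close>
  this is a Cauchy estimate.\<close>

lemma power_series_on_bound:
  assumes "power_series_on f x0 c r" "0 < \<rho>" "\<rho> < r"
  shows "\<exists>C>0. \<forall>n. norm (c n) * \<rho> ^ n \<le> C"
proof -
  have "((\<lambda>n. \<rho> ^ n *\<^sub>R c n) has_sum f (x0 + \<rho>)) UNIV"
    using power_series_onD[OF assms(1), of "x0 + \<rho>"] assms by simp
  then have "Bseq (\<lambda>n. \<rho> ^ n *\<^sub>R c n)"
    by (intro convergent_imp_Bseq convergentI[of _ 0] summable_LIMSEQ_zero sums_summable)
      (rule has_sum_imp_sums)
  then show ?thesis
    using assms(2) by (auto simp: Bseq_def mult.commute)
qed

text \<open>Otherwise some coordinate of the difference would be a nontrivial expansion of the zero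
  function, whose zero at \<open>x0\<close> would then be isolated.\<close>

lemma power_series_on_unique:
  assumes c: "power_series_on f x0 c r" and d: "power_series_on f x0 d r" and "r > 0"
  shows "c = d"
proof (rule ccontr)
  assume "c \<noteq> d"
  then obtain n b where b: "b \<in> Basis" and n: "c n \<bullet> b \<noteq> d n \<bullet> b"
    by (metis euclidean_eq_iff ext)
  have *: "(\<lambda>n. (c n \<bullet> b - d n \<bullet> b) * (x - x0) ^ n) sums 0" if "norm (x - x0) < r" for x
    using sums_diff[of "\<lambda>n. (c n \<bullet> b) * (x - x0) ^ n" _ "\<lambda>n. (d n \<bullet> b) * (x - x0) ^ n"]
      c d b that unfolding power_series_on_iff_components
    by (fastforce simp: algebra_simps)
  \<comment> \<open>The constant term is settled by evaluation at \<open>x0\<close>, since the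
    isolation of zeros asks for a nonzero coefficient of positive index.\<close>
  have "c 0 \<bullet> b - d 0 \<bullet> b = 0"
    using sums_unique2[OF *[of x0]] powser_sums_zero[of "\<lambda>n. c n \<bullet> b - d n \<bullet> b"] \<open>r > 0\<close>
    by auto
  then have "n > 0" using n by (cases n) auto
  obtain s where "0 < s" "\<And>z. z \<in> cball x0 s - {x0} \<Longrightarrow> (0::real) \<noteq> 0"
    by (rule powser_0_nonzero[where f = "\<lambda>_. 0", OF \<open>r > 0\<close> *]) (use n \<open>n > 0\<close> in auto)
  from this(2)[of "x0 + s"] this(1) show False by (auto simp: dist_norm)
qed

text \<open>Termwise differentiation in every coordinate, reassembled over \<open>Basis\<close>. The
  radius stays \<open>r\<close>, so that repeated differentiation never shrinks the
  interval.\<close>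

lemma power_series_on_deriv:
  assumes ps: "power_series_on f x0 c r"
  shows power_series_on_has_derivative:
      "\<bar>x - x0\<bar> < r \<Longrightarrow> (f has_vector_derivative vector_derivative f (at x)) (at x)"
    and power_series_on_vector_derivative:
      "power_series_on (\<lambda>x. vector_derivative f (at x)) x0 (\<lambda>n. real (Suc n) *\<^sub>R c (Suc n)) r"
proof -
  define D where "D b x = (\<Sum>n. diffs (\<lambda>n. c n \<bullet> b) n * (x - x0) ^ n)" for b x
  have sums: "(\<lambda>n. (c n \<bullet> b) * z ^ n) sums (f (x0 + z) \<bullet> b)" if "b \<in> Basis" "norm z < r" for b z
  proof -
    from that have "\<bar>(x0 + z) - x0\<bar> < r" by simp
    with ps that show ?thesis unfolding power_series_on_iff_components by fastforce
  qed
  have D: "((\<lambda>x. f x \<bullet> b) has_field_derivative D b x) (at x)" if "b \<in> Basis" "\<bar>x - x0\<bar> < r" for b x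
  proof -
    have "((\<lambda>z. \<Sum>n. (c n \<bullet> b) * z ^ n) has_field_derivative D b x) (at (x - x0))"
      unfolding D_def using that sums
      by (intro termdiffs_strong'[where K = r]) (auto intro: sums_summable)
    then have "((\<lambda>z. f (x0 + z) \<bullet> b) has_field_derivative D b x) (at (x - x0))"
      by (rule has_field_derivative_transform_within_open[where S = "ball 0 r"])
        (use sums[OF that(1)] that(2) in \<open>auto simp: sums_iff\<close>)
    then show ?thesis
      using DERIV_shift[of "\<lambda>z. f (x0 + z) \<bullet> b" "D b x" "x" "-x0"] by simp
  qed
  have V: "(f has_vector_derivative (\<Sum>b\<in>Basis. D b x *\<^sub>R b)) (at x)" if "\<bar>x - x0\<bar> < r" for x
  proof -
    have "((\<lambda>x. \<Sum>b\<in>Basis. (f x \<bullet> b) *\<^sub>R b) has_vector_derivative (\<Sum>b\<in>Basis. D b x *\<^sub>R b)) (at x)"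
      using D that
      by (intro has_vector_derivative_sum)
        (auto intro!: derivative_eq_intros simp: has_real_derivative_iff_has_vector_derivative)
    then show ?thesis by (simp add: euclidean_representation)
  qed
  then show "(f has_vector_derivative vector_derivative f (at x)) (at x)" if "\<bar>x - x0\<bar> < r"
    using V[OF that] vector_derivative_at[OF V[OF that]] by simp
  show "power_series_on (\<lambda>x. vector_derivative f (at x)) x0 (\<lambda>n. real (Suc n) *\<^sub>R c (Suc n)) r"
    unfolding power_series_on_iff_components
  proof (intro ballI allI impI)
    fix b :: 'a and x assume b: "b \<in> Basis" and x: "\<bar>x - x0\<bar> < r"
    have "((\<lambda>z. f (x0 + z) \<bullet> b) has_field_derivative D b x) (at (x - x0))"
      using D[OF b x] DERIV_shift[of "\<lambda>x. f x \<bullet> b" "D b x" "x - x0" x0] by (simp add: add.commute)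
    then have "(\<lambda>n. diffs (\<lambda>n. c n \<bullet> b) n * (x - x0) ^ n) sums D b x"
      by (rule termdiffs_sums_strong[where K = r, rotated]) (use sums[OF b] x in auto)
    moreover have "vector_derivative f (at x) \<bullet> b = D b x"
      using vector_derivative_at[OF V[OF x]] b
      by simp
    ultimately show "(\<lambda>n. ((real (Suc n) *\<^sub>R c (Suc n)) \<bullet> b) * (x - x0) ^ n) sums (vector_derivative f (at x) \<bullet> b)"
      by (simp add: diffs_def)
  qed
qed

section \<open>Cauchy products and linear combinations of power series\<close>

lemma summable_on_times_nonneg:
  fixes u :: "'i \<Rightarrow> real" and v :: "'j \<Rightarrow> real"
  assumes u: "u summable_on UNIV" "\<And>i. 0 \<le> u i" and v: "v summable_on UNIV" "\<And>j. 0 \<le> v j"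
  shows "(\<lambda>(i, j). u i * v j) summable_on UNIV"
proof -
  have "(\<lambda>(i, j). u i * v j) summable_on UNIV \<times> UNIV"
  proof (rule summable_on_SigmaI)
    have "((\<lambda>j. u i * v j) has_sum u i * (\<Sum>\<^sub>\<infinity>j. v j)) UNIV" for i
      using v(1) by (intro has_sum_cmult_right has_sum_infsum)
    then show "((\<lambda>j. case (i, j) of (i, j) \<Rightarrow> u i * v j) has_sum u i * (\<Sum>\<^sub>\<infinity>j. v j)) UNIV" for i
      by simp
    show "(\<lambda>i. u i * (\<Sum>\<^sub>\<infinity>j. v j)) summable_on UNIV"
      using u(1) by (rule summable_on_cmult_left)
  qed (use u v in auto)
  then show ?thesis by simp
qed

text \<open>Joint summability permits summing over \<open>j\<close> and then over \<open>i\<close>,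
  where bilinearity pulls the sums out; the quadrant is then cut along the antidiagonals
  \<open>i + j = n\<close>.\<close>

lemma (in bounded_bilinear) has_sum_Cauchy_product:
  fixes x :: "nat \<Rightarrow> 'a" and y :: "nat \<Rightarrow> 'b"
  assumes x: "(x has_sum X) UNIV" and y: "(y has_sum Y) UNIV"
    and prod: "(\<lambda>(i, j). prod (x i) (y j)) summable_on UNIV"
  shows "((\<lambda>n. \<Sum>i\<le>n. prod (x i) (y (n - i))) has_sum prod X Y) UNIV"
proof -
  have "((\<lambda>(i, j). prod (x i) (y j)) has_sum prod X Y) (UNIV \<times> UNIV)"
  proof (rule has_sum_SigmaI)
    show "((\<lambda>j. case (i, j) of (i, j) \<Rightarrow> prod (x i) (y j)) has_sum prod (x i) Y) UNIV" for i
      using has_sum_bounded_linear[OF bounded_linear_right y] by simp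
    show "((\<lambda>i. prod (x i) Y) has_sum prod X Y) UNIV"
      using has_sum_bounded_linear[OF bounded_linear_left x] .
  qed (use prod in simp)
  also have "?this \<longleftrightarrow> ((\<lambda>(n, i). prod (x i) (y (n - i))) has_sum prod X Y) (SIGMA n:UNIV. {..n})"
    by (rule has_sum_reindex_bij_witness[where i = "\<lambda>(n, i). (i, n - i)" and j = "\<lambda>(i, j). (i + j, i)"]) auto
  finally show ?thesis
    by (rule has_sum_SigmaD) (auto intro: has_sum_finiteI)
qed

lemma power_series_on_bilinear:
  fixes prod :: "'a::euclidean_space \<Rightarrow> 'b::euclidean_space \<Rightarrow> 'c::euclidean_space"
  assumes bb: "bounded_bilinear prod"
    and f: "power_series_on f x0 c r" and g: "power_series_on g x0 d r"
  shows "power_series_on (\<lambda>x. prod (f x) (g x)) x0 (\<lambda>n. \<Sum>i\<le>n. prod (c i) (d (n - i))) r"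
  unfolding power_series_on_def
proof (intro allI impI)
  fix x assume x: "\<bar>x - x0\<bar> < r"
  interpret bounded_bilinear prod by fact
  let ?x = "\<lambda>n. (x - x0) ^ n *\<^sub>R c n" and ?y = "\<lambda>n. (x - x0) ^ n *\<^sub>R d n"
  have X: "(?x has_sum f x) UNIV" and Y: "(?y has_sum g x) UNIV"
    using f g x by (auto simp: power_series_on_def)
  obtain K where K: "K > 0" "\<And>a b. norm (prod a b) \<le> norm a * norm b * K"
    using pos_bounded by blast
  have nX: "(\<lambda>n. norm (?x n)) summable_on UNIV" and nY: "(\<lambda>n. norm (?y n)) summable_on UNIV"
    using has_sum_imp_summable[OF X, THEN summable_on_euclidean_iff_abs[THEN iffD1]]
      has_sum_imp_summable[OF Y, THEN summable_on_euclidean_iff_abs[THEN iffD1]] by auto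
  \<comment> \<open>In finite dimension both factors are absolutely summable, so the products of
    their norms, times \<open>K\<close>, dominate the family of products jointly.\<close>
  have "(\<lambda>(i, j). norm (?x i) * (norm (?y j) * K)) summable_on UNIV"
    using nX summable_on_cmult_left[OF nY, of K] \<open>K > 0\<close> by (intro summable_on_times_nonneg) auto
  then have "(\<lambda>z. norm (norm (?x (fst z)) * (norm (?y (snd z)) * K))) summable_on UNIV"
    using \<open>K > 0\<close> by (simp add: case_prod_unfold abs_mult)
  then have "(\<lambda>z. norm (prod (?x (fst z)) (?y (snd z)))) summable_on UNIV"
  proof (rule Infinite_Sum.abs_summable_on_comparison_test)
    fix z
    show "norm (prod (?x (fst z)) (?y (snd z))) \<le> norm (norm (?x (fst z)) * (norm (?y (snd z)) * K))"
      using K(2)[of "?x (fst z)" "?y (snd z)"] K(1) by (simp add: mult.assoc del: norm_scaleR)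
  qed
  then have "(\<lambda>(i, j). prod (?x i) (?y j)) summable_on UNIV"
    unfolding case_prod_unfold by (rule summable_on_euclidean_iff_abs[THEN iffD2])
  from has_sum_Cauchy_product[OF X Y this]
  show "((\<lambda>n. (x - x0) ^ n *\<^sub>R (\<Sum>i\<le>n. prod (c i) (d (n - i)))) has_sum prod (f x) (g x)) UNIV"
  proof (rule has_sum_cong[THEN iffD1, rotated])
    fix n
    have "prod (?x i) (?y (n - i)) = (x - x0) ^ n *\<^sub>R prod (c i) (d (n - i))" if "i \<le> n" for i
      using that by (simp add: scaleR_left scaleR_right flip: power_add)
    then show "(\<Sum>i\<le>n. prod (?x i) (?y (n - i))) = (x - x0) ^ n *\<^sub>R (\<Sum>i\<le>n. prod (c i) (d (n - i)))"
      by (simp add: scaleR_sum_right)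
  qed
qed

lemma power_series_on_sum:
  assumes "\<And>j. j \<in> J \<Longrightarrow> power_series_on (f j) x0 (c j) r"
  shows "power_series_on (\<lambda>x. \<Sum>j\<in>J. f j x) x0 (\<lambda>n. \<Sum>j\<in>J. c j n) r"
  using assms unfolding power_series_on_def
  by (auto simp: scaleR_sum_right intro!: has_sum_sum_family)

lemma power_series_on_scaleR:
  assumes "power_series_on f x0 c r"
  shows "power_series_on (\<lambda>x. k *\<^sub>R f x) x0 (\<lambda>n. k *\<^sub>R c n) r"
  unfolding power_series_on_def
proof (intro allI impI)
  fix x assume "\<bar>x - x0\<bar> < r"
  then have "((\<lambda>n. (x - x0) ^ n *\<^sub>R c n) has_sum f x) UNIV" using assms by (simp add: power_series_on_def)
  from has_sum_bounded_linear[OF bounded_linear_scaleR_right[of k] this]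
  show "((\<lambda>n. (x - x0) ^ n *\<^sub>R k *\<^sub>R c n) has_sum k *\<^sub>R f x) UNIV" by (simp add: mult.commute)
qed

text \<open>A nonzero coefficient of positive index would make the zero at \<open>x0\<close>
  isolated, contrary to the accumulation of zeros there.\<close>

lemma power_series_on_identity:
  assumes f: "power_series_on f x0 c r" and "r > 0"
    and zeros: "x0 islimpt {x. f x = 0}"
  shows "\<bar>x - x0\<bar> < r \<Longrightarrow> f x = 0"
proof -
  have "c n = 0" for n
  proof (rule ccontr)
    assume "c n \<noteq> 0"
    then obtain b where b: "b \<in> Basis" and n: "c n \<bullet> b \<noteq> 0"
      using euclidean_all_zero_iff[of "c n"] by blast
    have *: "(\<lambda>n. (c n \<bullet> b) * (x - x0) ^ n) sums (f x \<bullet> b)" if "norm (x - x0) < r" for x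
      using f b that by (simp add: power_series_on_iff_components)
    have "isCont f x0"
      using power_series_on_has_derivative[OF f, of x0] \<open>r > 0\<close>
      by (simp add: has_vector_derivative_continuous)
    \<comment> \<open>Continuity carries the value 0 from the accumulating zeros to
      \<open>x0\<close>, which disposes of the constant term.\<close>
    have "f x0 = 0"
    proof (rule ccontr)
      assume "f x0 \<noteq> 0"
      with \<open>isCont f x0\<close> have "\<forall>\<^sub>F x in at x0. f x \<noteq> 0"
        using tendsto_imp_eventually_ne[of f "f x0" "at x0" 0] by (simp add: isCont_def)
      then show False using zeros by (simp add: islimpt_iff_eventually)
    qed
    then have "c 0 \<bullet> b = 0"
      using sums_unique2[OF *[of x0]] powser_sums_zero[of "\<lambda>n. c n \<bullet> b"] \<open>r > 0\<close> by auto
    then have "n > 0" using n by (cases n) auto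
    obtain s where s: "0 < s" "\<And>z. z \<in> cball x0 s - {x0} \<Longrightarrow> f z \<bullet> b \<noteq> 0"
      by (rule powser_0_nonzero[where f = "\<lambda>x. f x \<bullet> b", OF \<open>r > 0\<close> *])
        (use n \<open>n > 0\<close> \<open>f x0 = 0\<close> in auto)
    then have "\<forall>\<^sub>F x in at x0. f x \<noteq> 0"
      unfolding eventually_at by (intro exI[of _ s]) (force simp: dist_commute)
    then show False using zeros by (simp add: islimpt_iff_eventually)
  qed
  then show "\<bar>x - x0\<bar> < r \<Longrightarrow> f x = 0"
    using f has_sum_unique[of "\<lambda>_::nat. 0" UNIV "f x" 0] by (simp add: power_series_on_def)
qed

text \<open>Connectedness of the interval: the interior of the zero set is open, and it is
  relatively closed because the expansion at a limit point of zeros vanishes identically.\<close>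

lemma identity_interval:
  fixes f :: "real \<Rightarrow> 'a::euclidean_space"
  assumes ps: "\<And>x. x \<in> {l<..<u} \<Longrightarrow> \<exists>c r. r > 0 \<and> power_series_on f x c r"
    and p: "p \<in> {l<..<u}" "\<forall>\<^sub>F x in nhds p. f x = 0"
    and x: "x \<in> {l<..<u}"
  shows "f x = 0"
proof -
  define A where "A = {x. \<forall>\<^sub>F y in nhds x. f y = 0}"
  have "open A"
    unfolding A_def open_subopen[of "Collect _"] eventually_nhds by blast
  have lim: "x \<in> A" if x: "x \<in> {l<..<u}" "x islimpt {x. f x = 0}" for x
  proof -
    obtain c r where "r > 0" "power_series_on f x c r" using ps x(1) by blast
    from power_series_on_identity[OF this(2,1) x(2)] \<open>r > 0\<close> show ?thesis
      unfolding A_def eventually_nhds_metric mem_Collect_eq by (auto simp: dist_norm)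
  qed
  have "A \<subseteq> {x. f x = 0}" unfolding A_def using eventually_nhds_x_imp_x by blast
  then have cl: "x \<in> A" if "x \<in> {l<..<u}" "x islimpt A" for x
    using lim islimpt_subset that by blast
  have "openin (top_of_set {l<..<u}) ({l<..<u} \<inter> A)"
    using \<open>open A\<close> by (simp add: openin_open_Int)
  moreover have "closedin (top_of_set {l<..<u}) ({l<..<u} \<inter> A)"
    unfolding closedin_limpt using cl islimpt_subset by blast
  moreover have "connected {l<..<u}" by simp
  ultimately have "{l<..<u} \<inter> A = {} \<or> {l<..<u} \<inter> A = {l<..<u}"
    unfolding connected_clopen by blast
  moreover have "p \<in> {l<..<u} \<inter> A" using p by (simp add: A_def)
  ultimately have "x \<in> A" using x by blast
  then show ?thesis using \<open>A \<subseteq> _\<close> by blast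
qed

section \<open>Vector-valued power series in two variables\<close>

lemma summable_on_Sigma_fiber:
  fixes f :: "'i \<times> 'j \<Rightarrow> 'a::banach"
  assumes "f summable_on Sigma A B" "x \<in> A"
  shows "(\<lambda>y. f (x, y)) summable_on B x"
proof -
  have "f summable_on Pair x ` B x"
    by (rule summable_on_subset_banach[OF assms(1)]) (use assms(2) in auto)
  then show ?thesis by (simp add: summable_on_reindex inj_on_def o_def)
qed

text \<open>A box replaces the disc of \<open>real_analytic2_on\<close>, so that either variable can
  be frozen without shrinking the range of the other.\<close>

definition double_series_on ::
    "(real \<Rightarrow> real \<Rightarrow> 'a::euclidean_space) \<Rightarrow> real \<Rightarrow> real \<Rightarrow> (nat \<Rightarrow> nat \<Rightarrow> 'a) \<Rightarrow> real \<Rightarrow> bool" where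
  "double_series_on F s0 t0 c r \<longleftrightarrow>
     (\<forall>s t. \<bar>s - s0\<bar> < r \<longrightarrow> \<bar>t - t0\<bar> < r \<longrightarrow>
        ((\<lambda>(m, n). ((s - s0) ^ m * (t - t0) ^ n) *\<^sub>R c m n) has_sum F s t) UNIV)"

lemma double_series_onD:
  "double_series_on F s0 t0 c r \<Longrightarrow> \<bar>s - s0\<bar> < r \<Longrightarrow> \<bar>t - t0\<bar> < r \<Longrightarrow>
     ((\<lambda>(m, n). ((s - s0) ^ m * (t - t0) ^ n) *\<^sub>R c m n) has_sum F s t) UNIV"
  by (simp add: double_series_on_def)

lemma double_series_on_mono: "double_series_on F s0 t0 c r \<Longrightarrow> r' \<le> r \<Longrightarrow> double_series_on F s0 t0 c r'"
  by (auto simp: double_series_on_def)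

lemma double_series_on_swap:
  assumes "double_series_on F s0 t0 c r"
  shows "double_series_on (\<lambda>t s. F s t) t0 s0 (\<lambda>n m. c m n) r"
  unfolding double_series_on_def
proof (intro allI impI)
  fix t s assume "\<bar>t - t0\<bar> < r" "\<bar>s - s0\<bar> < r"
  then have "((\<lambda>(m, n). ((s - s0) ^ m * (t - t0) ^ n) *\<^sub>R c m n) has_sum F s t) (UNIV \<times> UNIV)"
    using double_series_onD[OF assms] by simp
  then show "((\<lambda>(n, m). ((t - t0) ^ n * (s - s0) ^ m) *\<^sub>R c m n) has_sum F s t) UNIV"
    by (subst (asm) has_sum_swap) (simp add: mult.commute)
qed

lemma double_series_on_abs_summable:
  assumes "double_series_on F s0 t0 c r" "\<bar>x\<bar> < r" "\<bar>y\<bar> < r"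
  shows "(\<lambda>(m, n). \<bar>x\<bar> ^ m * \<bar>y\<bar> ^ n * norm (c m n)) summable_on UNIV"
proof -
  have "((\<lambda>(m, n). (x ^ m * y ^ n) *\<^sub>R c m n) has_sum F (s0 + x) (t0 + y)) UNIV"
    using double_series_onD[OF assms(1), of "s0 + x" "t0 + y"] assms by simp
  from has_sum_imp_summable[OF this, THEN summable_on_euclidean_iff_abs[THEN iffD1]]
  show ?thesis by (simp add: case_prod_unfold abs_mult power_abs)
qed

lemma double_series_on_bound:
  assumes "double_series_on F s0 t0 c r" "0 < \<rho>" "\<rho> < r"
  shows "\<exists>C. \<forall>m n. norm (c m n) * \<rho> ^ m * \<rho> ^ n \<le> C"
proof -
  let ?f = "\<lambda>(m, n). \<rho> ^ m * \<rho> ^ n * norm (c m n)"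
  have f: "?f summable_on UNIV"
    using double_series_on_abs_summable[OF assms(1), of \<rho> \<rho>] assms by simp
  have "norm (c m n) * \<rho> ^ m * \<rho> ^ n \<le> infsum ?f UNIV" for m n
    using finite_sum_le_infsum[OF f, of "{(m, n)}"] assms by (auto simp: mult_ac)
  then show ?thesis by blast
qed

lemma double_series_on_column:
  assumes F: "double_series_on F s0 t0 c r" and "r > 0"
  shows "power_series_on (\<lambda>s. \<Sum>\<^sub>\<infinity>m. (s - s0) ^ m *\<^sub>R c m n) s0 (\<lambda>m. c m n) r"
  unfolding power_series_on_def
proof (intro allI impI has_sum_infsum)
  fix s assume s: "\<bar>s - s0\<bar> < r"
  \<comment> \<open>Freezing \<open>t - t0\<close> at the nonzero value \<open>r / 2\<close>
    exhibits the column as a fibre of a summable double family, up to the factor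
    \<open>(r / 2) ^ n\<close>.\<close>
  have "((\<lambda>(n, m). ((r / 2) ^ n * (s - s0) ^ m) *\<^sub>R c m n) summable_on (UNIV \<times> UNIV))"
    using has_sum_imp_summable[OF double_series_onD[OF double_series_on_swap[OF F] _ s, of "t0 + r / 2"]]
      \<open>r > 0\<close> by simp
  from summable_on_Sigma_fiber[OF this, of n]
  have "(\<lambda>m. (1 / (r / 2) ^ n) *\<^sub>R (((r / 2) ^ n * (s - s0) ^ m) *\<^sub>R c m n)) summable_on UNIV"
    by (intro summable_on_scaleR_right) simp
  then show "(\<lambda>m. (s - s0) ^ m *\<^sub>R c m n) summable_on UNIV"
    using \<open>r > 0\<close> by simp
qed

text \<open>Fubini for unordered sums: the inner sum over \<open>m\<close> is the coefficient
  function of \<open>(t - t0) ^ n\<close>, evaluated at \<open>s\<close>.\<close>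

lemma double_series_on_slice:
  assumes F: "double_series_on F s0 t0 c r" and s: "\<bar>s - s0\<bar> < r"
  shows "power_series_on (F s) t0 (\<lambda>n. \<Sum>\<^sub>\<infinity>m. (s - s0) ^ m *\<^sub>R c m n) r"
  unfolding power_series_on_def
proof (intro allI impI)
  fix t assume t: "\<bar>t - t0\<bar> < r"
  have "((\<lambda>(n, m). ((t - t0) ^ n * (s - s0) ^ m) *\<^sub>R c m n) has_sum F s t) (UNIV \<times> UNIV)"
    using double_series_onD[OF double_series_on_swap[OF F] t s] by simp
  then show "((\<lambda>n. (t - t0) ^ n *\<^sub>R (\<Sum>\<^sub>\<infinity>m. (s - s0) ^ m *\<^sub>R c m n)) has_sum F s t) UNIV"
  proof (rule has_sum_SigmaD)
    fix n
    have "((\<lambda>m. (s - s0) ^ m *\<^sub>R c m n) has_sum (\<Sum>\<^sub>\<infinity>m. (s - s0) ^ m *\<^sub>R c m n)) UNIV"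
      using power_series_onD[OF double_series_on_column[OF F] s] s by simp
    from has_sum_bounded_linear[OF bounded_linear_scaleR_right[of "(t - t0) ^ n"] this]
    show "((\<lambda>m. case (n, m) of (n, m) \<Rightarrow> ((t - t0) ^ n * (s - s0) ^ m) *\<^sub>R c m n) has_sum
        (t - t0) ^ n *\<^sub>R (\<Sum>\<^sub>\<infinity>m. (s - s0) ^ m *\<^sub>R c m n)) UNIV"
      by simp
  qed
qed

text \<open>Termwise differentiation in \<open>s\<close> identifies the iterated sum. Joint
  summability comes from Cauchy estimates on a slightly smaller box, the factor \<open>m + 1\<close>
  being harmless against a geometric series.\<close>

lemma double_series_on_deriv:
  assumes F: "double_series_on F s0 t0 c r"
  shows "double_series_on (\<lambda>s t. vector_derivative (\<lambda>s'. F s' t) (at s)) s0 t0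
           (\<lambda>m n. real (Suc m) *\<^sub>R c (Suc m) n) r"
  unfolding double_series_on_def
proof (intro allI impI)
  fix s t assume s: "\<bar>s - s0\<bar> < r" and t: "\<bar>t - t0\<bar> < r"
  define e where "e m = (\<Sum>\<^sub>\<infinity>n. (t - t0) ^ n *\<^sub>R c m n)" for m
  let ?g = "\<lambda>(m, n). ((s - s0) ^ m * (t - t0) ^ n) *\<^sub>R (real (Suc m) *\<^sub>R c (Suc m) n)"
  obtain \<rho> where \<rho>: "max \<bar>s - s0\<bar> \<bar>t - t0\<bar> < \<rho>" "\<rho> < r"
    using s t dense[of "max \<bar>s - s0\<bar> \<bar>t - t0\<bar>" r] by auto
  then have "\<rho> > 0" by linarith
  obtain C where C: "\<And>m n. norm (c m n) * \<rho> ^ m * \<rho> ^ n \<le> C"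
    using double_series_on_bound[OF F \<open>\<rho> > 0\<close> \<rho>(2)] by blast
  \<comment> \<open>Both ratios are below 1, and the Cauchy estimate bounds the terms by
    \<open>C / \<rho>\<close> times \<open>(m + 1) * x ^ m * y ^ n\<close>.\<close>
  define x y where "x = \<bar>s - s0\<bar> / \<rho>" and "y = \<bar>t - t0\<bar> / \<rho>"
  have xy: "0 \<le> x" "x < 1" "0 \<le> y" "y < 1"
    using \<rho> \<open>\<rho> > 0\<close> by (auto simp: x_def y_def)
  have "(\<lambda>m. real (Suc m) * x ^ m) summable_on UNIV"
    using geometric_deriv_sums[of x] xy
    by (intro summable_nonneg_imp_summable_on) (auto simp: sums_iff)
  moreover have "(\<lambda>n. y ^ n) summable_on UNIV"
    using xy by (intro summable_nonneg_imp_summable_on) (auto intro: summable_geometric)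
  ultimately have "(\<lambda>(m, n). (real (Suc m) * x ^ m) * y ^ n) summable_on UNIV"
    using xy by (intro summable_on_times_nonneg) auto
  from summable_on_cmult_right[OF this, of "C / \<rho>"]
  have "(\<lambda>z. norm (C / \<rho> * (case z of (m, n) \<Rightarrow> (real (Suc m) * x ^ m) * y ^ n))) summable_on UNIV"
    by (rule summable_on_iff_abs_summable_on_real[THEN iffD1])
  then have "(\<lambda>z. norm (?g z)) summable_on UNIV"
  proof (rule Infinite_Sum.abs_summable_on_comparison_test)
    fix z :: "nat \<times> nat"
    obtain m n where z: "z = (m, n)" by (cases z)
    have "norm (c (Suc m) n) \<le> C / (\<rho> ^ Suc m * \<rho> ^ n)"
      using C[of "Suc m" n] \<open>\<rho> > 0\<close> by (simp add: field_simps)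
    then have "(\<bar>s - s0\<bar> ^ m * \<bar>t - t0\<bar> ^ n * real (Suc m)) * norm (c (Suc m) n)
        \<le> (\<bar>s - s0\<bar> ^ m * \<bar>t - t0\<bar> ^ n * real (Suc m)) * (C / (\<rho> ^ Suc m * \<rho> ^ n))"
      by (rule mult_left_mono) simp
    moreover have "norm (?g z) = (\<bar>s - s0\<bar> ^ m * \<bar>t - t0\<bar> ^ n * real (Suc m)) * norm (c (Suc m) n)"
      unfolding z by (simp add: abs_mult power_abs)
    ultimately have "norm (?g z) \<le> \<bar>s - s0\<bar> ^ m * \<bar>t - t0\<bar> ^ n * (real (Suc m) * (C / (\<rho> ^ Suc m * \<rho> ^ n)))"
      by simp
    also have "\<dots> = C / \<rho> * ((real (Suc m) * x ^ m) * y ^ n)"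
      using \<open>\<rho> > 0\<close> by (simp add: x_def y_def power_divide field_simps)
    finally show "norm (?g z) \<le> norm (C / \<rho> * (case z of (m, n) \<Rightarrow> (real (Suc m) * x ^ m) * y ^ n))"
      unfolding z real_norm_def prod.case by linarith
  qed
  then have sm: "?g summable_on UNIV" by (rule abs_summable_summable)
  have "(?g has_sum vector_derivative (\<lambda>s'. F s' t) (at s)) (UNIV \<times> UNIV)"
  proof (rule has_sum_SigmaI)
    have "power_series_on (\<lambda>s. F s t) s0 e r"
      unfolding e_def using double_series_on_slice[OF double_series_on_swap[OF F] t] .
    from power_series_onD[OF power_series_on_vector_derivative[OF this] s]
    show "((\<lambda>m. (s - s0) ^ m *\<^sub>R (real (Suc m) *\<^sub>R e (Suc m))) has_sum
        vector_derivative (\<lambda>s'. F s' t) (at s)) UNIV" .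
    fix m
    have "((\<lambda>n. (t - t0) ^ n *\<^sub>R c (Suc m) n) has_sum e (Suc m)) UNIV"
      unfolding e_def using power_series_onD[OF double_series_on_column[OF double_series_on_swap[OF F]] t] t by simp
    from has_sum_bounded_linear[OF bounded_linear_scaleR_right[of "(s - s0) ^ m * real (Suc m)"] this]
    show "((\<lambda>n. ?g (m, n)) has_sum (s - s0) ^ m *\<^sub>R (real (Suc m) *\<^sub>R e (Suc m))) UNIV"
      by (simp add: mult_ac)
  qed (use sm in simp)
  then show "(?g has_sum vector_derivative (\<lambda>s'. F s' t) (at s)) UNIV" by simp
qed

text \<open>With \<open>h = t1 - t0\<close> and \<open>\<tau> = t - t1\<close>, the power
  \<open>(\<tau> + h) ^ n\<close> is expanded binomially. The resulting triple family is absolutely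
  summable because \<open>\<bar>h\<bar> + \<bar>\<tau>\<bar> < r\<close>, so the powers of
  \<open>\<tau>\<close> can be collected.\<close>

lemma double_series_on_shift_snd:
  assumes F: "double_series_on F s0 t0 c r" and t1: "\<bar>t1 - t0\<bar> < r"
  shows "\<exists>d. double_series_on F s0 t1 d (r - \<bar>t1 - t0\<bar>)"
proof
  define h where "h = t1 - t0"
  define d where "d m k = (\<Sum>\<^sub>\<infinity>n\<in>{k..}. (real (n choose k) * h ^ (n - k)) *\<^sub>R c m n)" for m k
  show "double_series_on F s0 t1 d (r - \<bar>t1 - t0\<bar>)"
    unfolding double_series_on_def
  proof (intro allI impI)
    fix s t assume s: "\<bar>s - s0\<bar> < r - \<bar>t1 - t0\<bar>" and t: "\<bar>t - t1\<bar> < r - \<bar>t1 - t0\<bar>"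
    define x \<tau> where "x = s - s0" and "\<tau> = t - t1"
    let ?I = "(SIGMA z:UNIV. {..snd z}) :: ((nat \<times> nat) \<times> nat) set" and ?J = "(SIGMA z:UNIV. {snd z..}) :: ((nat \<times> nat) \<times> nat) set"
    define f where "f = (\<lambda>((m::nat, n), k). (x ^ m * (real (n choose k) * h ^ (n - k) * \<tau> ^ k)) *\<^sub>R c m n)"
    have "((\<lambda>(m, n). (x ^ m * (t - t0) ^ n) *\<^sub>R c m n) has_sum F s t) UNIV"
      using double_series_onD[OF F, of s t] s t by (simp add: x_def)
    have sm: "(\<lambda>(m, n). \<bar>x\<bar> ^ m * (\<bar>h\<bar> + \<bar>\<tau>\<bar>) ^ n * norm (c m n)) summable_on UNIV"
      using double_series_on_abs_summable[OF F, of x "\<bar>h\<bar> + \<bar>\<tau>\<bar>"] s t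
      by (simp add: x_def \<tau>_def h_def)
    have inner: "(\<Sum>k\<le>n. f ((m, n), k)) = (x ^ m * (t - t0) ^ n) *\<^sub>R c m n" for m n
    proof -
      have "(t - t0) ^ n = (\<tau> + h) ^ n" by (simp add: \<tau>_def h_def)
      also have "\<dots> = (\<Sum>k\<le>n. real (n choose k) * h ^ (n - k) * \<tau> ^ k)"
        by (subst binomial_ring) (simp add: mult_ac)
      finally show ?thesis
        by (simp add: f_def sum_distrib_left scaleR_sum_left)
    qed
    have ninner: "(\<Sum>k\<le>n. norm (f ((m, n), k))) = \<bar>x\<bar> ^ m * (\<bar>h\<bar> + \<bar>\<tau>\<bar>) ^ n * norm (c m n)" for m n
    proof -
      have "(\<bar>h\<bar> + \<bar>\<tau>\<bar>) ^ n = (\<Sum>k\<le>n. real (n choose k) * \<bar>h\<bar> ^ (n - k) * \<bar>\<tau>\<bar> ^ k)"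
        by (subst add.commute, subst binomial_ring) (simp add: mult_ac)
      then show ?thesis
        by (simp add: f_def sum_distrib_left sum_distrib_right abs_mult power_abs mult_ac)
    qed
    have "(\<lambda>z. norm (f z)) summable_on ?I"
    proof (rule summable_on_SigmaI)
      show "((\<lambda>k. norm (f (z, k))) has_sum (case z of (m, n) \<Rightarrow> \<bar>x\<bar> ^ m * (\<bar>h\<bar> + \<bar>\<tau>\<bar>) ^ n * norm (c m n)))
          {..snd z}" for z
        using ninner by (cases z) (auto intro!: has_sum_finiteI)
    qed (use sm in auto)
    then have "f summable_on ?I" by (rule abs_summable_summable)
    then have "(f has_sum F s t) ?I"
    proof (rule has_sum_SigmaI[rotated 2])
      show "((\<lambda>k. f (z, k)) has_sum (case z of (m, n) \<Rightarrow> (x ^ m * (t - t0) ^ n) *\<^sub>R c m n)) {..snd z}" for z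
        using inner by (cases z) (auto intro!: has_sum_finiteI)
    qed fact
    \<comment> \<open>The range \<open>k \<le> n\<close> is now read with \<open>k\<close> outside
      and \<open>n\<close> inside; up to powers of \<open>x\<close> and \<open>\<tau>\<close> the
      inner sums are the new coefficients \<open>d m k\<close>.\<close>
    also have "?this \<longleftrightarrow> ((\<lambda>((m, k), n). f ((m, n), k)) has_sum F s t) ?J"
      by (rule has_sum_reindex_bij_witness[where i = "\<lambda>((m, k), n). ((m, n), k)" and j = "\<lambda>((m, n), k). ((m, k), n)"]) auto
    finally have J: "((\<lambda>((m, k), n). f ((m, n), k)) has_sum F s t) ?J" .
    have fiber: "((\<lambda>n. f ((m, n), k)) has_sum (x ^ m * \<tau> ^ k) *\<^sub>R d m k) {k..}" for m k
    proof -
      have "(\<lambda>n. f ((m, n), k)) summable_on {k..}"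
        using summable_on_Sigma_fiber[OF has_sum_imp_summable[OF J], of "(m, k)"] by simp
      moreover have "infsum (\<lambda>n. f ((m, n), k)) {k..} = (x ^ m * \<tau> ^ k) *\<^sub>R d m k"
        unfolding d_def infsum_scaleR_right[symmetric] by (simp add: f_def mult_ac)
      ultimately show ?thesis by (simp add: has_sum_iff)
    qed
    have "((\<lambda>(m, k). (x ^ m * \<tau> ^ k) *\<^sub>R d m k) has_sum F s t) UNIV"
      by (rule has_sum_SigmaD[OF J]) (use fiber in auto)
    then show "((\<lambda>(m, k). ((s - s0) ^ m * (t - t1) ^ k) *\<^sub>R d m k) has_sum F s t) UNIV"
      by (simp add: x_def \<tau>_def)
  qed
qed

text \<open>One variable is moved at a time. The first move leaves a radius above
  \<open>r / 2\<close>, so the new centre in \<open>t\<close> is still inside.\<close>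

lemma double_series_on_shift:
  assumes F: "double_series_on F s0 t0 c r" and "\<bar>s1 - s0\<bar> < r / 2" "\<bar>t1 - t0\<bar> < r / 2"
  shows "\<exists>d r'. r' > 0 \<and> double_series_on F s1 t1 d r'"
proof -
  have "\<bar>s1 - s0\<bar> < r" using assms(2) by linarith
  then obtain d where "double_series_on (\<lambda>t s. F s t) t0 s1 d (r - \<bar>s1 - s0\<bar>)"
    using double_series_on_shift_snd[OF double_series_on_swap[OF F]] by blast
  from double_series_on_swap[OF this] have "double_series_on F s1 t0 (\<lambda>m n. d n m) (r / 2)"
    by (rule double_series_on_mono) (use assms in simp)
  from double_series_on_shift_snd[OF this assms(3)] show ?thesis
    using assms(3) by (meson diff_gt_0_iff_gt)
qed

section \<open>The majorant\<close>

text \<open>The first index is the power of \<open>t\<close>, the second that of \<open>s\<close>.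
  The inner sum is the Cauchy product of one coefficient function with the
  \<open>s\<close>-derivative of another, whence the weight \<open>m - i + 1\<close>.\<close>

fun double_coeff :: "('a::real_vector \<Rightarrow> 'a \<Rightarrow> 'a) \<Rightarrow> (nat \<Rightarrow> 'a) \<Rightarrow> nat \<Rightarrow> nat \<Rightarrow> 'a" where
  "double_coeff B c 0 m = c m"
| "double_coeff B c (Suc n) m = (1 / real (Suc n)) *\<^sub>R (\<Sum>k\<le>n. \<Sum>i\<le>m.
     B (double_coeff B c k i) (real (Suc (m - i)) *\<^sub>R double_coeff B c (n - k) (Suc (m - i))))"

text \<open>The values are \<open>C * (L * C) ^ n\<close> times the Catalan numbers.\<close>

fun majorant :: "real \<Rightarrow> real \<Rightarrow> nat \<Rightarrow> real" where
  "majorant C L 0 = C"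
| "majorant C L (Suc n) = L * (\<Sum>k\<le>n. majorant C L k * majorant C L (n - k))"

lemma majorant_nonneg: "0 \<le> C \<Longrightarrow> 0 \<le> L \<Longrightarrow> 0 \<le> majorant C L n"
  by (induction n rule: less_induct; case_tac x) (auto intro!: mult_nonneg_nonneg sum_nonneg)

text \<open>With \<open>h n = majorant C L n * x ^ n\<close>, each partial sum is at most \<open>C + L * x\<close> times the square of the
  previous one, so for \<open>x = 1 / (4 * L * C)\<close> all of them stay below \<open>2 * C\<close>.\<close>

lemma majorant_le_geometric:
  assumes "0 < C" "0 < L"
  shows "majorant C L n \<le> 2 * C * (4 * L * C) ^ n"
proof -
  define x where "x = 1 / (4 * L * C)"
  define h where "h n = majorant C L n * x ^ n" for n
  have h0: "0 \<le> h n" for n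
    using majorant_nonneg[of C L n] assms by (simp add: h_def x_def)
  have hSuc: "h (Suc n) = L * x * (\<Sum>k\<le>n. h k * h (n - k))" for n
  proof -
    have "h k * h (n - k) = x ^ n * (majorant C L k * majorant C L (n - k))" if "k \<le> n" for k
    proof -
      have "x ^ n = x ^ k * x ^ (n - k)" using that by (simp flip: power_add)
      then show ?thesis by (simp only: h_def mult_ac)
    qed
    then have "(\<Sum>k\<le>n. h k * h (n - k)) = x ^ n * (\<Sum>k\<le>n. majorant C L k * majorant C L (n - k))"
      by (simp add: sum_distrib_left)
    then show ?thesis by (simp add: h_def)
  qed
  have partial: "(\<Sum>n\<le>N. h n) \<le> 2 * C" for N
  proof (induction N)
    case 0
    then show ?case using assms by (simp add: h_def)
  next
    case (Suc N)
    \<comment> \<open>The convolutions up to \<open>N\<close> fill the triangle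
      \<open>k + j \<le> N\<close>. Enlarging it to a square only adds nonnegative terms and yields
      the square of the partial sum.\<close>
    have "(\<Sum>n\<le>N. \<Sum>k\<le>n. h k * h (n - k)) = (\<Sum>(n, k)\<in>(SIGMA n:{..N}. {..n}). h k * h (n - k))"
      by (simp add: sum.Sigma)
    also have "\<dots> = (\<Sum>(k, j)\<in>{(k, j). k + j \<le> N}. h k * h j)"
      by (rule sum.reindex_bij_witness[where i = "\<lambda>(k, j). (k + j, k)" and j = "\<lambda>(n, k). (k, n - k)"]) auto
    also have "\<dots> \<le> (\<Sum>(k, j)\<in>{..N} \<times> {..N}. h k * h j)"
      using h0 by (intro sum_mono2) auto
    also have "\<dots> = (\<Sum>n\<le>N. h n) ^ 2"
      by (simp add: power2_eq_square sum_product sum.cartesian_product)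
    also have "\<dots> \<le> (2 * C) ^ 2"
      using Suc.IH h0 by (intro power_mono sum_nonneg)
    finally have "(\<Sum>n\<le>N. \<Sum>k\<le>n. h k * h (n - k)) \<le> 4 * C ^ 2" by (simp add: power2_eq_square)
    then have "L * x * (\<Sum>n\<le>N. \<Sum>k\<le>n. h k * h (n - k)) \<le> L * x * (4 * C ^ 2)"
      using assms by (intro mult_left_mono) (auto simp: x_def)
    also have "\<dots> = C" using assms by (simp add: x_def power2_eq_square)
    finally have "(\<Sum>n\<le>N. h (Suc n)) \<le> C"
      by (simp add: hSuc sum_distrib_left)
    moreover have "(\<Sum>n\<le>Suc N. h n) = C + (\<Sum>n\<le>N. h (Suc n))"
      unfolding sum.atMost_Suc_shift by (simp add: h_def)
    ultimately show ?case by simp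
  qed
  have "h n \<le> (\<Sum>n\<le>n. h n)" using h0 by (intro member_le_sum) auto
  also have "\<dots> \<le> 2 * C" by (rule partial)
  finally show ?thesis
    using assms by (simp add: h_def x_def power_divide field_simps)
qed

section \<open>Powers of the geometric series as comparison functions\<close>

definition geom_fps :: "real \<Rightarrow> real fps" where
  "geom_fps R = Abs_fps (\<lambda>n. R ^ n)"

lemma geom_fps_nth [simp]: "fps_nth (geom_fps R) n = R ^ n"
  by (simp add: geom_fps_def)

text \<open>Formal version of the rule that differentiating \<open>1 / (1 - R s) ^ p\<close> raises
  the order of the pole by one.\<close>

lemma fps_deriv_geom_fps_power:
  "fps_deriv (geom_fps R ^ p) = fps_const (real p * R) * geom_fps R ^ Suc p"
proof (cases p)
  case (Suc q)
  have "fps_deriv (geom_fps R) = fps_const R * (geom_fps R * geom_fps R)"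
  proof (rule fps_ext)
    fix n
    have "(\<Sum>i=0..n. R ^ i * R ^ (n - i)) = (\<Sum>i=0..n. R ^ n)"
      by (intro sum.cong) (auto simp flip: power_add)
    then have "fps_nth (geom_fps R * geom_fps R) n = real (Suc n) * R ^ n"
      by (simp add: fps_mult_nth)
    then show "fps_nth (fps_deriv (geom_fps R)) n = fps_nth (fps_const R * (geom_fps R * geom_fps R)) n"
      by (simp add: algebra_simps)
  qed
  then show ?thesis
    unfolding fps_deriv_power[of _ p]
    by (simp only: Suc fps_const_mult[symmetric] diff_Suc_1 power_Suc mult_ac)
qed simp

lemma geom_fps_power_nonneg: "0 \<le> R \<Longrightarrow> 0 \<le> fps_nth (geom_fps R ^ p) m"
  by (induction p arbitrary: m) (auto simp: fps_mult_nth intro!: sum_nonneg)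

text \<open>A further factor convolves with the powers of \<open>R\<close>; since
  \<open>2 ^ 0 + ... + 2 ^ m < 2 ^ (m + 1)\<close>, it costs only a factor 2.\<close>

lemma geom_fps_power_le:
  assumes "0 \<le> R"
  shows "fps_nth (geom_fps R ^ p) m \<le> 2 ^ p * (2 * R) ^ m"
proof (induction p arbitrary: m)
  case 0
  then show ?case using assms by (simp add: fps_one_nth)
next
  case (Suc p)
  have "fps_nth (geom_fps R ^ Suc p) m = (\<Sum>i=0..m. fps_nth (geom_fps R ^ p) i * R ^ (m - i))"
    by (subst power_Suc2) (simp add: fps_mult_nth)
  also have "\<dots> \<le> (\<Sum>i=0..m. (2 ^ p * (2 * R) ^ i) * R ^ (m - i))"
    using Suc.IH assms by (intro sum_mono mult_right_mono) auto
  also have "\<dots> = (\<Sum>i=0..m. 2 ^ p * R ^ m * 2 ^ i)"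
    by (intro sum.cong) (auto simp: power_mult_distrib simp flip: power_add)
  also have "\<dots> = 2 ^ p * R ^ m * (2 ^ Suc m - 1)"
    using sum_gp_basic[of "2::real" m] by (simp only: sum_distrib_left[symmetric] atLeast0AtMost) simp
  also have "\<dots> \<le> 2 ^ p * R ^ m * 2 ^ Suc m"
    using assms by (intro mult_left_mono) auto
  finally show ?case by (simp add: power_mult_distrib mult_ac)
qed

text \<open>The coefficient of \<open>t ^ n\<close> is dominated by that of the solution of the scalar equation
  \<open>y\<^sub>t = K y y\<^sub>s\<close> with \<open>y(s, 0) = C / (1 - R s)\<close>, whose \<open>n\<close>-th coefficient is a multiple of
  \<open>1 / (1 - R s) ^ (2 n + 1)\<close>. Replacing the exact weight \<open>(2 (n - k) + 1) / (n + 1)\<close> by \<open>2\<close> gives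
  the Catalan-type recursion for \<open>majorant\<close>.\<close>

lemma norm_double_coeff_le_majorant:
  fixes B :: "'a::real_normed_vector \<Rightarrow> 'a \<Rightarrow> 'a"
  assumes K: "\<And>x y. norm (B x y) \<le> norm x * norm y * K" "0 < K"
    and c: "\<And>m. norm (c m) \<le> C * R ^ m" and "0 < C" "0 < R"
  shows "norm (double_coeff B c n m)
           \<le> majorant C (2 * K * R) n * fps_nth (geom_fps R ^ (2 * n + 1)) m"
proof (induction n arbitrary: m rule: less_induct)
  case (less n)
  show ?case
  proof (cases n)
    case 0
    then show ?thesis using c by simp
  next
    case (Suc N)
    define \<beta> where "\<beta> = majorant C (2 * K * R)"
    define G where "G p = fps_nth (geom_fps R ^ p)" for p
    have \<beta>0: "0 \<le> \<beta> k" for k using majorant_nonneg assms by (simp add: \<beta>_def)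
    have G0: "0 \<le> G p i" for p i using geom_fps_power_nonneg assms by (simp add: G_def)
    have IH: "norm (double_coeff B c k i) \<le> \<beta> k * G (2 * k + 1) i" if "k \<le> N" for k i
      using less.IH[of k i] that Suc by (simp add: \<beta>_def G_def)
    \<comment> \<open>The weight and the index shift caused by the \<open>s\<close>-derivative are
      absorbed exactly by one more power of the geometric series and the factor
      \<open>p * R\<close>.\<close>
    have deriv: "real (Suc i) * G p (Suc i) = real p * R * G (Suc p) i" for p i
    proof -
      have "real (Suc i) * G p (Suc i) = fps_nth (fps_deriv (geom_fps R ^ p)) i"
        by (simp add: G_def)
      then show ?thesis unfolding fps_deriv_geom_fps_power by (simp add: G_def del: power_Suc)
    qed
    have inner: "norm (\<Sum>i\<le>m. B (double_coeff B c k i) (real (Suc (m - i)) *\<^sub>R double_coeff B c (N - k) (Suc (m - i))))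
        \<le> real (Suc N) * (2 * K * R * (\<beta> k * \<beta> (N - k)) * G (2 * n + 1) m)" if k: "k \<le> N" for k
    proof -
      have "norm (\<Sum>i\<le>m. B (double_coeff B c k i) (real (Suc (m - i)) *\<^sub>R double_coeff B c (N - k) (Suc (m - i))))
        \<le> (\<Sum>i\<le>m. (\<beta> k * G (2 * k + 1) i) * (real (Suc (m - i)) * (\<beta> (N - k) * G (2 * (N - k) + 1) (Suc (m - i)))) * K)"
      proof (intro order.trans[OF norm_sum] sum_mono)
        fix i
        have "norm (B (double_coeff B c k i) (real (Suc (m - i)) *\<^sub>R double_coeff B c (N - k) (Suc (m - i))))
          \<le> norm (double_coeff B c k i) * (real (Suc (m - i)) * norm (double_coeff B c (N - k) (Suc (m - i)))) * K"
          using K(1)[of "double_coeff B c k i" "real (Suc (m - i)) *\<^sub>R double_coeff B c (N - k) (Suc (m - i))"]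
          by simp
        also have "\<dots> \<le> (\<beta> k * G (2 * k + 1) i) * (real (Suc (m - i)) * (\<beta> (N - k) * G (2 * (N - k) + 1) (Suc (m - i)))) * K"
          using IH[OF k, of i] IH[of "N - k" "Suc (m - i)"] \<open>0 < K\<close> \<beta>0 G0
          by (intro mult_right_mono mult_mono mult_left_mono) auto
        finally show "norm (B (double_coeff B c k i) (real (Suc (m - i)) *\<^sub>R double_coeff B c (N - k) (Suc (m - i))))
          \<le> (\<beta> k * G (2 * k + 1) i) * (real (Suc (m - i)) * (\<beta> (N - k) * G (2 * (N - k) + 1) (Suc (m - i)))) * K" .
      qed
      also have "\<dots> = (\<Sum>i\<le>m. (K * R * (\<beta> k * \<beta> (N - k)) * real (2 * (N - k) + 1)) * (G (2 * k + 1) i * G (2 * (N - k) + 2) (m - i)))"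
      proof (rule sum.cong[OF refl])
        fix i
        show "(\<beta> k * G (2 * k + 1) i) * (real (Suc (m - i)) * (\<beta> (N - k) * G (2 * (N - k) + 1) (Suc (m - i)))) * K
          = (K * R * (\<beta> k * \<beta> (N - k)) * real (2 * (N - k) + 1)) * (G (2 * k + 1) i * G (2 * (N - k) + 2) (m - i))"
        proof -
          have "(\<beta> k * G (2 * k + 1) i) * (real (Suc (m - i)) * (\<beta> (N - k) * G (2 * (N - k) + 1) (Suc (m - i)))) * K
            = (K * (\<beta> k * \<beta> (N - k)) * G (2 * k + 1) i) * (real (Suc (m - i)) * G (2 * (N - k) + 1) (Suc (m - i)))"
            by (simp only: mult_ac)
          then show ?thesis unfolding deriv by (simp add: mult_ac)
        qed
      qed
      \<comment> \<open>The exponents \<open>2 * k + 1\<close> and \<open>2 * (N - k) + 2\<close>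
        add up to \<open>2 * n + 1\<close> because \<open>n = N + 1\<close>, so the convolution no
        longer depends on \<open>k\<close>.\<close>
      also have "\<dots> = (K * R * (\<beta> k * \<beta> (N - k)) * real (2 * (N - k) + 1)) * G (2 * n + 1) m"
      proof -
        have "geom_fps R ^ (2 * n + 1) = geom_fps R ^ (2 * k + 1) * geom_fps R ^ (2 * (N - k) + 2)"
          unfolding power_add[symmetric] using k Suc by (intro arg_cong[where f = "(^) _"]) simp
        then show ?thesis
          by (simp add: G_def fps_mult_nth atLeast0AtMost sum_distrib_left del: power_Suc)
      qed
      \<comment> \<open>The bound \<open>2 * (N - k) + 1 \<le> 2 * (N + 1)\<close> is chosen so that
        \<open>N + 1\<close> cancels the division in the recursion.\<close>
      also have "\<dots> \<le> (K * R * (\<beta> k * \<beta> (N - k)) * (2 * real (Suc N))) * G (2 * n + 1) m"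
        using \<beta>0 G0 assms k by (intro mult_right_mono mult_left_mono) auto
      finally show ?thesis by (simp only: mult_ac)
    qed
    have "norm (double_coeff B c n m) \<le> (1 / real (Suc N)) *
        (\<Sum>k\<le>N. real (Suc N) * (2 * K * R * (\<beta> k * \<beta> (N - k)) * G (2 * n + 1) m))"
      unfolding Suc double_coeff.simps norm_scaleR using inner unfolding Suc
      by (intro mult_mono sum_norm_le) auto
    also have "\<dots> = \<beta> n * G (2 * n + 1) m"
      unfolding sum_distrib_left[symmetric] sum_distrib_right[symmetric] Suc \<beta>_def by simp
    finally show ?thesis by (simp add: \<beta>_def G_def)
  qed
qed

text \<open>Joint geometric growth in both indices is what yields a positive radius in
  \<open>s\<close> and \<open>t\<close> at once.\<close>

lemma double_coeff_bound:
  fixes B :: "'a::real_normed_vector \<Rightarrow> 'a \<Rightarrow> 'a"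
  assumes "bounded_bilinear B" and c: "\<And>m. norm (c m) \<le> C * R ^ m" and "0 < C" "0 < R"
  shows "\<exists>A P. 0 < P \<and> (\<forall>n m. norm (double_coeff B c n m) \<le> A * P ^ m * P ^ n)"
proof -
  obtain K where K: "0 < K" "\<And>x y. norm (B x y) \<le> norm x * norm y * K"
    using bounded_bilinear.pos_bounded[OF assms(1)] by blast
  \<comment> \<open>\<open>Q\<close> collects what is raised to the power \<open>n\<close>:
    \<open>4 * L * C\<close> with \<open>L = 2 * K * R\<close> from the majorant, and
    \<open>4\<close> from \<open>2 ^ (2 * n)\<close>.\<close>
  define Q where "Q = 4 * (2 * K * R) * C * 4"
  define P where "P = max (2 * R) Q"
  have "0 < Q" "0 < P" using K assms by (auto simp: Q_def P_def)
  have "norm (double_coeff B c n m) \<le> (4 * C) * P ^ m * P ^ n" for n m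
  proof -
    have "norm (double_coeff B c n m) \<le> majorant C (2 * K * R) n * fps_nth (geom_fps R ^ (2 * n + 1)) m"
      using K assms by (intro norm_double_coeff_le_majorant) auto
    also have "\<dots> \<le> (2 * C * (4 * (2 * K * R) * C) ^ n) * (2 ^ (2 * n + 1) * (2 * R) ^ m)"
      using K assms by (intro mult_mono majorant_le_geometric geom_fps_power_le geom_fps_power_nonneg) auto
    also have "\<dots> = (4 * C) * (2 * R) ^ m * Q ^ n"
    proof -
      have "(2::real) ^ (2 * n + 1) = 2 * 4 ^ n" by (simp add: power_mult)
      then show ?thesis unfolding Q_def power_mult_distrib by simp
    qed
    also have "\<dots> \<le> (4 * C) * P ^ m * P ^ n"
      using assms \<open>0 < Q\<close> \<open>0 < P\<close> by (intro mult_mono power_mono) (auto simp: P_def)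
    finally show ?thesis .
  qed
  then show ?thesis using \<open>0 < P\<close> by blast
qed

section \<open>Power series solutions of the quadratic evolution equation\<close>

text \<open>Since \<open>vector_derivative\<close> is total, the recursion defines functions of
  every real \<open>s\<close> without reference to a centre; they are the intended coefficients
  where \<open>f\<close> is analytic.\<close>

fun time_coeff :: "('a::real_normed_vector \<Rightarrow> 'a \<Rightarrow> 'a) \<Rightarrow> (real \<Rightarrow> 'a) \<Rightarrow> nat \<Rightarrow> real \<Rightarrow> 'a" where
  "time_coeff B f 0 s = f s"
| "time_coeff B f (Suc n) s = (1 / real (Suc n)) *\<^sub>R (\<Sum>k\<le>n.
     B (time_coeff B f k s) (vector_derivative (\<lambda>s'. time_coeff B f (n - k) s') (at s)))"

text \<open>The infinite sum is 0 where the series is not summable. As no centre in \<open>s\<close>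
  enters, expansions around different points belong to one function.\<close>

definition series_solution :: "('a::real_normed_vector \<Rightarrow> 'a \<Rightarrow> 'a) \<Rightarrow> (real \<Rightarrow> 'a) \<Rightarrow> real \<Rightarrow> real \<Rightarrow> 'a" where
  "series_solution B f s t = (\<Sum>\<^sub>\<infinity>n. t ^ n *\<^sub>R time_coeff B f n s)"

lemma has_sum_zero_power:
  fixes c :: "nat \<Rightarrow> 'a::real_normed_vector"
  shows "((\<lambda>n. 0 ^ n *\<^sub>R c n) has_sum c 0) UNIV"
  by (rule has_sum_finite_neutralI[of "{0}"]) auto

lemma series_solution_0 [simp]: "series_solution B f s 0 = f s"
  using infsumI[OF has_sum_zero_power[of "\<lambda>n. time_coeff B f n s"]]
  by (simp add: series_solution_def)

text \<open>Derivatives, products and sums keep the interval of convergence, so the one radius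
  \<open>r\<close> serves every \<open>n\<close>.\<close>

lemma power_series_on_time_coeff:
  fixes B :: "'a::euclidean_space \<Rightarrow> 'a \<Rightarrow> 'a"
  assumes "bounded_bilinear B" and f: "power_series_on f s0 c r"
  shows "power_series_on (time_coeff B f n) s0 (double_coeff B c n) r"
proof (induction n rule: less_induct)
  case (less n)
  show ?case
  proof (cases n)
    case 0
    then show ?thesis using f by (simp add: power_series_on_def)
  next
    case (Suc N)
    have eqs: "time_coeff B f n = (\<lambda>s. (1 / real (Suc N)) *\<^sub>R (\<Sum>k\<le>N.
          B (time_coeff B f k s) (vector_derivative (time_coeff B f (N - k)) (at s))))"
      "double_coeff B c n = (\<lambda>m. (1 / real (Suc N)) *\<^sub>R (\<Sum>k\<le>N. \<Sum>i\<le>m.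
          B (double_coeff B c k i) (real (Suc (m - i)) *\<^sub>R double_coeff B c (N - k) (Suc (m - i)))))"
      by (auto simp: Suc)
    show ?thesis
      unfolding eqs using assms(1) less.IH Suc
      by (intro power_series_on_scaleR power_series_on_sum power_series_on_bilinear[OF assms(1)]
          power_series_on_vector_derivative) auto
  qed
qed

lemma double_series_on_series_solution:
  fixes B :: "'a::euclidean_space \<Rightarrow> 'a \<Rightarrow> 'a"
  assumes bb: "bounded_bilinear B" and f: "power_series_on f s0 c r" and "0 < r"
  shows "\<exists>r'. 0 < r' \<and> r' \<le> r \<and> double_series_on (series_solution B f) s0 0 (\<lambda>m n. double_coeff B c n m) r'"
proof -
  define R where "R = 2 / r"
  have "R > 0" using \<open>0 < r\<close> by (simp add: R_def)
  obtain C where C: "C > 0" "\<And>m. norm (c m) * (r / 2) ^ m \<le> C"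
    using power_series_on_bound[OF f, of "r / 2"] \<open>0 < r\<close> by auto
  have "norm (c m) \<le> C * R ^ m" for m
    using C(2)[of m] \<open>0 < r\<close> by (simp add: R_def power_divide field_simps)
  from double_coeff_bound[OF bb this C(1) \<open>R > 0\<close>]
  obtain A P where P: "P > 0" and A: "\<And>n m. norm (double_coeff B c n m) \<le> A * P ^ m * P ^ n"
    by blast
  \<comment> \<open>Growth of the coefficients by at most \<open>P\<close> per index gives
    convergence for distances below \<open>1 / P\<close>; the bound \<open>r\<close> keeps the
    expansions of \<open>time_coeff\<close> valid.\<close>
  define r' where "r' = min r (1 / P)"
  have "double_series_on (series_solution B f) s0 0 (\<lambda>m n. double_coeff B c n m) r'"
    unfolding double_series_on_def
  proof (intro allI impI)
    fix s t :: real assume "\<bar>s - s0\<bar> < r'" "\<bar>t - 0\<bar> < r'"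
    then have st: "\<bar>s - s0\<bar> < r" "\<bar>s - s0\<bar> * P < 1" "\<bar>t\<bar> * P < 1"
      using P by (auto simp: r'_def field_simps)
    let ?g = "\<lambda>(n, m). (t ^ n * (s - s0) ^ m) *\<^sub>R double_coeff B c n m"
    have geom: "(\<lambda>n. (\<bar>x\<bar> * P) ^ n) summable_on UNIV" if "\<bar>x\<bar> * P < 1" for x
      using that P by (intro summable_nonneg_imp_summable_on summable_geometric) auto
    have "(\<lambda>(n, m). (\<bar>t\<bar> * P) ^ n * (\<bar>s - s0\<bar> * P) ^ m) summable_on UNIV"
      using geom st P by (intro summable_on_times_nonneg) auto
    from summable_on_cmult_right[OF this, of A]
    have "(\<lambda>z. norm (A * (case z of (n, m) \<Rightarrow> (\<bar>t\<bar> * P) ^ n * (\<bar>s - s0\<bar> * P) ^ m))) summable_on UNIV"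
      by (rule summable_on_iff_abs_summable_on_real[THEN iffD1])
    then have "(\<lambda>z. norm (?g z)) summable_on UNIV"
    proof (rule Infinite_Sum.abs_summable_on_comparison_test)
      fix z :: "nat \<times> nat"
      obtain n m where z: "z = (n, m)" by (cases z)
      have "norm (?g z) \<le> (\<bar>t\<bar> ^ n * \<bar>s - s0\<bar> ^ m) * (A * P ^ m * P ^ n)"
        unfolding z using A by (auto simp: abs_mult power_abs intro!: mult_left_mono)
      also have "\<dots> = A * (case z of (n, m) \<Rightarrow> (\<bar>t\<bar> * P) ^ n * (\<bar>s - s0\<bar> * P) ^ m)"
        unfolding z by (simp add: power_mult_distrib)
      finally show "norm (?g z) \<le> norm (A * (case z of (n, m) \<Rightarrow> (\<bar>t\<bar> * P) ^ n * (\<bar>s - s0\<bar> * P) ^ m))"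
        by simp
    qed
    then have "?g summable_on UNIV \<times> UNIV" by (simp add: abs_summable_summable)
    then have g: "(?g has_sum infsum ?g (UNIV \<times> UNIV)) (UNIV \<times> UNIV)" by (rule has_sum_infsum)
    \<comment> \<open>Summing over the powers of \<open>s\<close> first recovers
      \<open>time_coeff\<close>, so the double sum is the series in \<open>t\<close> that defines
      the solution.\<close>
    have "((\<lambda>n. t ^ n *\<^sub>R time_coeff B f n s) has_sum infsum ?g (UNIV \<times> UNIV)) UNIV"
    proof (rule has_sum_SigmaD[OF g])
      fix n
      have "((\<lambda>m. (s - s0) ^ m *\<^sub>R double_coeff B c n m) has_sum time_coeff B f n s) UNIV"
        using power_series_onD[OF power_series_on_time_coeff[OF bb f] st(1)] .
      from has_sum_bounded_linear[OF bounded_linear_scaleR_right[of "t ^ n"] this]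
      show "((\<lambda>m. ?g (n, m)) has_sum t ^ n *\<^sub>R time_coeff B f n s) UNIV" by simp
    qed
    then have "series_solution B f s t = infsum ?g (UNIV \<times> UNIV)"
      unfolding series_solution_def by (rule infsumI)
    with g have "(?g has_sum series_solution B f s t) (UNIV \<times> UNIV)" by simp
    then show "((\<lambda>(m, n). ((s - s0) ^ m * (t - 0) ^ n) *\<^sub>R double_coeff B c n m) has_sum
        series_solution B f s t) UNIV"
      by (subst (asm) has_sum_swap) (simp add: mult.commute)
  qed
  moreover have "0 < r'" "r' \<le> r" using \<open>0 < r\<close> P by (auto simp: r'_def)
  ultimately show ?thesis by blast
qed

text \<open>Used to read the evolution equation at a fixed \<open>s\<close> as an identity of power
  series in \<open>t\<close>, hence as a recursion for the functions \<open>b n\<close>.\<close>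

lemma double_series_on_slices:
  assumes F: "double_series_on F s0 t0 c r" and s: "\<bar>s - s0\<bar> < r"
    and b: "\<And>n. power_series_on (b n) s0 (\<lambda>m. c m n) r"
  shows power_series_on_time: "power_series_on (F s) t0 (\<lambda>n. b n s) r"
    and power_series_on_time_deriv:
      "power_series_on (\<lambda>t. vector_derivative (\<lambda>s'. F s' t) (at s)) t0
         (\<lambda>n. vector_derivative (b n) (at s)) r"
proof -
  have *: "(\<Sum>\<^sub>\<infinity>m. (s - s0) ^ m *\<^sub>R c m n) = b n s" for n
    using power_series_onD[OF b s] by (rule infsumI)
  show "power_series_on (F s) t0 (\<lambda>n. b n s) r"
    using double_series_on_slice[OF F s] unfolding * .
  have **: "(\<Sum>\<^sub>\<infinity>m. (s - s0) ^ m *\<^sub>R (real (Suc m) *\<^sub>R c (Suc m) n)) = vector_derivative (b n) (at s)" for n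
    using power_series_onD[OF power_series_on_vector_derivative[OF b] s] by (rule infsumI)
  show "power_series_on (\<lambda>t. vector_derivative (\<lambda>s'. F s' t) (at s)) t0
         (\<lambda>n. vector_derivative (b n) (at s)) r"
    using double_series_on_slice[OF double_series_on_deriv[OF F] s] unfolding ** .
qed

text \<open>Both sides are power series in \<open>t\<close>, and the recursion for
  \<open>time_coeff\<close> says precisely that their coefficients agree.\<close>

lemma series_solution_equation:
  fixes B :: "'a::euclidean_space \<Rightarrow> 'a \<Rightarrow> 'a"
  assumes bb: "bounded_bilinear B" and f: "power_series_on f s0 c r"
    and w: "double_series_on (series_solution B f) s0 0 (\<lambda>m n. double_coeff B c n m) r"
    and s: "\<bar>s - s0\<bar> < r" and t: "\<bar>t\<bar> < r"
  shows "vector_derivative (series_solution B f s) (at t) =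
      B (series_solution B f s t) (vector_derivative (\<lambda>s'. series_solution B f s' t) (at s))"
proof -
  note a = power_series_on_time_coeff[OF bb f]
  note ps = power_series_on_time[OF w s a]
  have "real (Suc n) *\<^sub>R time_coeff B f (Suc n) s =
      (\<Sum>k\<le>n. B (time_coeff B f k s) (vector_derivative (time_coeff B f (n - k)) (at s)))" for n
    by simp
  with power_series_on_vector_derivative[OF ps]
  have "power_series_on (\<lambda>t. vector_derivative (series_solution B f s) (at t)) 0
     (\<lambda>n. \<Sum>k\<le>n. B (time_coeff B f k s) (vector_derivative (time_coeff B f (n - k)) (at s))) r"
    by (simp only:)
  from power_series_onD[OF this, of t]
    power_series_onD[OF power_series_on_bilinear[OF bb ps power_series_on_time_deriv[OF w s a]], of t] t
  show ?thesis by (auto intro: has_sum_unique)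
qed

text \<open>Comparing coefficients of powers of \<open>t\<close> forces the recursion of
  \<open>time_coeff\<close> on the coefficient functions of \<open>F\<close>, which are thus
  determined by \<open>f\<close>.\<close>

lemma local_uniqueness:
  fixes B :: "'a::euclidean_space \<Rightarrow> 'a \<Rightarrow> 'a"
  assumes bb: "bounded_bilinear B" and F: "double_series_on F s0 0 c r" and "0 < r"
    and F0: "\<And>s. \<bar>s - s0\<bar> < r \<Longrightarrow> F s 0 = f s"
    and eq: "\<And>s t. \<bar>s - s0\<bar> < r \<Longrightarrow> \<bar>t\<bar> < r \<Longrightarrow>
        vector_derivative (F s) (at t) = B (F s t) (vector_derivative (\<lambda>s'. F s' t) (at s))"
    and s: "\<bar>s - s0\<bar> < r" and t: "\<bar>t\<bar> < r"
  shows "F s t = series_solution B f s t"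
proof -
  define b where "b n s = (\<Sum>\<^sub>\<infinity>m. (s - s0) ^ m *\<^sub>R c m n)" for n s
  have b: "power_series_on (b n) s0 (\<lambda>m. c m n) r" for n
    unfolding b_def by (rule double_series_on_column[OF F \<open>0 < r\<close>])
  have "b n s = time_coeff B f n s" if "\<bar>s - s0\<bar> < r" for n s
    using that
  proof (induction n arbitrary: s rule: less_induct)
    case (less n)
    note ps = power_series_on_time[OF F less.prems b]
    show ?case
    proof (cases n)
      case 0
      have "((\<lambda>n. 0 ^ n *\<^sub>R b n s) has_sum b 0 s) UNIV" by (rule has_sum_zero_power)
      with power_series_onD[OF ps, of 0] \<open>0 < r\<close> have "F s 0 = b 0 s"
        by (auto intro: has_sum_unique)
      then show ?thesis using F0[OF less.prems] 0 by simp
    next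
      case (Suc N)
      have *: "power_series_on (\<lambda>t. vector_derivative (F s) (at t)) 0
          (\<lambda>n. \<Sum>k\<le>n. B (b k s) (vector_derivative (b (n - k)) (at s))) r"
        by (rule power_series_on_cong[OF power_series_on_bilinear[OF bb ps
              power_series_on_time_deriv[OF F less.prems b]]])
           (use eq[OF less.prems] in simp)
      have "(\<lambda>n. real (Suc n) *\<^sub>R b (Suc n) s) = (\<lambda>n. \<Sum>k\<le>n. B (b k s) (vector_derivative (b (n - k)) (at s)))"
        by (rule power_series_on_unique[OF power_series_on_vector_derivative[OF ps] * \<open>0 < r\<close>])
      then have "real (Suc N) *\<^sub>R b (Suc N) s = (\<Sum>k\<le>N. B (b k s) (vector_derivative (b (N - k)) (at s)))"
        by (rule fun_cong)
      also have "\<dots> = (\<Sum>k\<le>N. B (time_coeff B f k s) (vector_derivative (time_coeff B f (N - k)) (at s)))"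
      proof (intro sum.cong refl arg_cong2[where f = B] vector_derivative_cong_eq)
        fix k assume "k \<in> {..N}"
        then show "b k s = time_coeff B f k s" using less Suc by auto
        \<comment> \<open>Equality at \<open>s\<close> alone would not identify derivatives; the
          induction hypothesis holds on the open ball around \<open>s0\<close>, hence near
          \<open>s\<close>.\<close>
        have "\<forall>\<^sub>F x in nhds s. x \<in> ball s0 r"
          using less.prems by (intro eventually_nhds_in_open) (auto simp: dist_real_def)
        then show "\<forall>\<^sub>F x in nhds s. x \<in> UNIV \<longrightarrow> b (N - k) x = time_coeff B f (N - k) x"
          by eventually_elim (use less.IH[of "N - k"] Suc in \<open>auto simp: dist_real_def\<close>)
      qed auto
      finally show ?thesis
        by (simp add: Suc del: of_nat_Suc) (metis (no_types, lifting) of_nat_Suc of_nat_neq_0 scaleR_scaleR scaleR_one nonzero_divide_eq_eq)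
    qed
  qed
  with power_series_onD[OF power_series_on_time[OF F s b], of t] t s
  have "((\<lambda>n. t ^ n *\<^sub>R time_coeff B f n s) has_sum F s t) UNIV" by simp
  then show ?thesis unfolding series_solution_def by (simp add: infsumI)
qed

section \<open>Existence and uniqueness over a compact interval\<close>

definition analytic2_at :: "(real \<Rightarrow> real \<Rightarrow> 'a::euclidean_space) \<Rightarrow> real \<Rightarrow> real \<Rightarrow> bool" where
  "analytic2_at F s t \<longleftrightarrow> (\<exists>c r. 0 < r \<and> double_series_on F s t c r)"

lemma analytic2_at_slice_snd: "analytic2_at F s t \<Longrightarrow> \<exists>c r. 0 < r \<and> power_series_on (F s) t c r"
  unfolding analytic2_at_def using double_series_on_slice[of F s t _ _ s] by fastforce

lemma analytic2_at_slice_fst: "analytic2_at F s t \<Longrightarrow> \<exists>c r. 0 < r \<and> power_series_on (\<lambda>s. F s t) s c r"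
  unfolding analytic2_at_def using double_series_on_slice[OF double_series_on_swap[of F s t], of _ _ t] by fastforce

lemma analytic2_at_has_derivative_fst:
  "analytic2_at F s t \<Longrightarrow> ((\<lambda>s'. F s' t) has_vector_derivative vector_derivative (\<lambda>s'. F s' t) (at s)) (at s)"
  using analytic2_at_slice_fst[of F s t] power_series_on_has_derivative[of "\<lambda>s. F s t" s _ _ s] by fastforce

lemma analytic2_at_has_derivative_snd:
  "analytic2_at F s t \<Longrightarrow> (F s has_vector_derivative vector_derivative (F s) (at t)) (at t)"
  using analytic2_at_slice_snd[of F s t] power_series_on_has_derivative[of "F s" t _ _ t] by fastforce

lemma power_series_on_diff:
  assumes "power_series_on f x0 c r" "power_series_on g x0 d r"
  shows "power_series_on (\<lambda>x. f x - g x) x0 (\<lambda>n. c n - d n) r"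
  using assms unfolding power_series_on_iff_components
  by (auto simp: inner_diff_left left_diff_distrib intro!: sums_diff)

lemma series_solution_exists:
  fixes B :: "'a::euclidean_space \<Rightarrow> 'a \<Rightarrow> 'a"
  assumes bb: "bounded_bilinear B"
    and f: "\<And>s. s \<in> {a..b} \<Longrightarrow> \<exists>c r. 0 < r \<and> power_series_on f s c r"
  shows "\<exists>\<epsilon>>0. \<exists>U. open U \<and> {a..b} \<times> {-\<epsilon><..<\<epsilon>} \<subseteq> U \<and>
    (\<forall>(s, t)\<in>U. analytic2_at (series_solution B f) s t \<and>
      vector_derivative (series_solution B f s) (at t) =
        B (series_solution B f s t) (vector_derivative (\<lambda>s'. series_solution B f s' t) (at s)))"
proof -
  let ?w = "series_solution B f"
  have "\<exists>r>0. \<exists>c. power_series_on f s c r \<and> double_series_on ?w s 0 (\<lambda>m n. double_coeff B c n m) r"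
    if "s \<in> {a..b}" for s
    using f[OF that] double_series_on_series_solution[OF bb] power_series_on_mono by meson
  then obtain r where r: "\<And>s. s \<in> {a..b} \<Longrightarrow> 0 < r s \<and>
      (\<exists>c. power_series_on f s c (r s) \<and> double_series_on ?w s 0 (\<lambda>m n. double_coeff B c n m) (r s))"
    by metis
  \<comment> \<open>The radii are halved because re-expansion at a nearby centre is available in the
    inner half of each box.\<close>
  define U where "U = (\<Union>s\<in>{a..b}. ball s (r s / 2) \<times> ball (0::real) (r s / 2))"
  have "open U" unfolding U_def by (intro open_UN ballI open_Times open_ball)
  have "analytic2_at ?w s t \<and>
      vector_derivative (?w s) (at t) = B (?w s t) (vector_derivative (\<lambda>s'. ?w s' t) (at s))"
    if st: "(s, t) \<in> U" for s t
  proof -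
    obtain s0 where s0: "s0 \<in> {a..b}" and "s \<in> ball s0 (r s0 / 2)" "t \<in> ball 0 (r s0 / 2)"
      using st unfolding U_def by blast
    then have st: "\<bar>s - s0\<bar> < r s0 / 2" "\<bar>t - 0\<bar> < r s0 / 2" by (simp_all add: dist_real_def abs_minus_commute)
    obtain c where c: "power_series_on f s0 c (r s0)"
      "double_series_on ?w s0 0 (\<lambda>m n. double_coeff B c n m) (r s0)" and "0 < r s0"
      using r[OF s0] by blast
    show ?thesis
      unfolding analytic2_at_def
      using double_series_on_shift[OF c(2) st] series_solution_equation[OF bb c, of s t] st \<open>0 < r s0\<close>
      by fastforce
  qed
  moreover obtain \<epsilon> where "0 < \<epsilon>" "{a..b} \<times> {-\<epsilon><..<\<epsilon>} \<subseteq> U"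
  proof -
    obtain S where S: "S \<subseteq> {a..b}" "finite S" "{a..b} \<subseteq> (\<Union>s\<in>S. ball s (r s / 2))"
      by (rule compactE_image[of "{a..b}" "{a..b}" "\<lambda>s. ball s (r s / 2)"]) (use r in \<open>auto intro: centre_in_ball[THEN iffD2]\<close>)
    \<comment> \<open>The element 1 keeps the minimum defined when \<open>S\<close> is empty, which
      can occur for an empty interval.\<close>
    define \<epsilon> where "\<epsilon> = Min (insert 1 ((\<lambda>s. r s / 2) ` S))"
    have "0 < \<epsilon>" unfolding \<epsilon>_def using S r by (subst Min_gr_iff) auto
    moreover have "(s, t) \<in> U" if "s \<in> {a..b}" "t \<in> {-\<epsilon><..<\<epsilon>}" for s t
    proof -
      obtain s0 where "s0 \<in> S" "s \<in> ball s0 (r s0 / 2)" using S(3) \<open>s \<in> {a..b}\<close> by blast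
      moreover have "\<epsilon> \<le> r s0 / 2" unfolding \<epsilon>_def using \<open>s0 \<in> S\<close> S(2) by (intro Min_le) auto
      ultimately show ?thesis
        unfolding U_def using S(1) that(2) by (intro UN_I[of s0]) auto
    qed
    ultimately show ?thesis using that by blast
  qed
  ultimately show ?thesis using \<open>open U\<close> by fast
qed

text \<open>The equation is known only for \<open>s\<close> in \<open>{a..b}\<close>, whereas
  \<open>local_uniqueness\<close> asks for it on a two-sided neighbourhood of \<open>s\<close>.
  Hence interior points come first, and the end points follow by continuity.\<close>

lemma analytic_solution_unique:
  fixes B :: "'a::euclidean_space \<Rightarrow> 'a \<Rightarrow> 'a"
  assumes bb: "bounded_bilinear B" and "a < b" "0 < \<epsilon>"
    and F: "\<And>s t. s \<in> {a..b} \<Longrightarrow> t \<in> {-\<epsilon><..<\<epsilon>} \<Longrightarrow> analytic2_at F s t \<and>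
        vector_derivative (F s) (at t) = B (F s t) (vector_derivative (\<lambda>s'. F s' t) (at s))"
      "\<And>s. s \<in> {a..b} \<Longrightarrow> F s 0 = f s"
    and G: "\<And>s t. s \<in> {a..b} \<Longrightarrow> t \<in> {-\<epsilon><..<\<epsilon>} \<Longrightarrow> analytic2_at G s t \<and>
        vector_derivative (G s) (at t) = B (G s t) (vector_derivative (\<lambda>s'. G s' t) (at s))"
      "\<And>s. s \<in> {a..b} \<Longrightarrow> G s 0 = f s"
    and s: "s \<in> {a..b}" and t: "t \<in> {-\<epsilon><..<\<epsilon>}"
  shows "F s t = G s t"
proof -
  have near0: "\<forall>\<^sub>F t in nhds 0. H s t = series_solution B f s t"
    if H: "\<And>s t. s \<in> {a..b} \<Longrightarrow> t \<in> {-\<epsilon><..<\<epsilon>} \<Longrightarrow> analytic2_at H s t \<and>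
        vector_derivative (H s) (at t) = B (H s t) (vector_derivative (\<lambda>s'. H s' t) (at s))"
      "\<And>s. s \<in> {a..b} \<Longrightarrow> H s 0 = f s" and s: "s \<in> {a<..<b}" for H s
  proof -
    obtain c r where r: "0 < r" and H': "double_series_on H s 0 c r"
      using H(1)[of s 0] s \<open>0 < \<epsilon>\<close> by (auto simp: analytic2_at_def)
    \<comment> \<open>This radius keeps the box around \<open>(s, 0)\<close> within the strip on
      which the equation holds.\<close>
    define r' where "r' = Min {r, s - a, b - s, \<epsilon>}"
    have r': "0 < r'" "r' \<le> r" "r' \<le> s - a" "r' \<le> b - s" "r' \<le> \<epsilon>"
      using r s \<open>0 < \<epsilon>\<close> by (auto simp: r'_def)
    have "H s t = series_solution B f s t" if "\<bar>t\<bar> < r'" for t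
      by (rule local_uniqueness[OF bb double_series_on_mono[OF H' r'(2)] r'(1) H(2) H(1)[THEN conjunct2]])
         (use r' that in auto)
    then show ?thesis
      unfolding eventually_nhds_metric using r'(1) by (auto simp: dist_real_def)
  qed
  have interior: "F s t - G s t = 0" if "s \<in> {a<..<b}" for s
  proof (rule identity_interval[where f = "\<lambda>t. F s t - G s t" and p = 0])
    have "\<forall>\<^sub>F t in nhds 0. F s t = series_solution B f s t"
      by (rule near0) (use F that in auto)
    moreover have "\<forall>\<^sub>F t in nhds 0. G s t = series_solution B f s t"
      by (rule near0) (use G that in auto)
    ultimately show "\<forall>\<^sub>F t in nhds 0. F s t - G s t = 0"
      by eventually_elim simp
    fix t assume t: "t \<in> {-\<epsilon><..<\<epsilon>}"
    have "s \<in> {a..b}" using that by simp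
    then obtain c r d r' where "0 < r" "power_series_on (F s) t c r" "0 < r'" "power_series_on (G s) t d r'"
      using F(1)[OF _ t] G(1)[OF _ t] analytic2_at_slice_snd by metis
    then have "power_series_on (\<lambda>t. F s t - G s t) t (\<lambda>n. c n - d n) (min r r')" "0 < min r r'"
      by (auto intro!: power_series_on_diff elim: power_series_on_mono)
    then show "\<exists>c r. 0 < r \<and> power_series_on (\<lambda>t. F s t - G s t) t c r" by blast
  qed (use t \<open>0 < \<epsilon>\<close> in auto)
  \<comment> \<open>For \<open>a < b\<close> the closure of the open interval contains both end
    points, so the vanishing of the difference extends to them.\<close>
  have "continuous_on (closure {a<..<b}) (\<lambda>s. F s t)" "continuous_on (closure {a<..<b}) (\<lambda>s. G s t)"
    using \<open>a < b\<close> F(1)[OF _ t] G(1)[OF _ t]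
    by (auto intro!: continuous_at_imp_continuous_on has_vector_derivative_continuous
        analytic2_at_has_derivative_fst)
  from continuous_constant_on_closure[OF continuous_on_diff[OF this] interior, of s]
  have "F s t - G s t = 0" using s \<open>a < b\<close> by simp
  then show ?thesis by simp
qed

section \<open>The cross product on R^7\<close>

lemma UNIV_7: "(UNIV :: 7 set) = {0, 1, 2, 3, 4, 5, 6}"
proof -
  have "card {0, 1, 2, 3, 4, 5, 6 :: 7} = CARD(7)" by simp
  from card_subset_eq[OF finite subset_UNIV this] show ?thesis by (rule sym)
qed

lemma sum_7: "sum f (UNIV :: 7 set) = f 0 + f 1 + f 2 + f 3 + f 4 + f 5 + f 6"
  unfolding UNIV_7 by (simp add: add_ac)

lemma forall_7: "(\<forall>i :: 7. P i) \<longleftrightarrow> P 0 \<and> P 1 \<and> P 2 \<and> P 3 \<and> P 4 \<and> P 5 \<and> P 6"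
  unfolding ball_UNIV[symmetric] UNIV_7 by simp

lemma inner_7: "(u :: real^7) \<bullet> v = u $ 0 * v $ 0 + u $ 1 * v $ 1 + u $ 2 * v $ 2 + u $ 3 * v $ 3
    + u $ 4 * v $ 4 + u $ 5 * v $ 5 + u $ 6 * v $ 6"
  by (simp add: inner_vec_def sum_7)

lemmas phi7_expand = phi7_def dx3_def coord_def

text \<open>Index \<open>i\<close> carries the coordinate numbered \<open>i + 1\<close>. With these
  formulas the identities below become polynomial identities, checked by expansion.\<close>

lemma cross7_nth:
  "cross7 u v $ 0 = u$1 * v$2 - u$2 * v$1 + u$3 * v$4 - u$4 * v$3 + u$5 * v$6 - u$6 * v$5"
  "cross7 u v $ 1 = u$2 * v$0 - u$0 * v$2 + u$3 * v$5 - u$5 * v$3 - u$4 * v$6 + u$6 * v$4"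
  "cross7 u v $ 2 = u$0 * v$1 - u$1 * v$0 - u$3 * v$6 + u$6 * v$3 - u$4 * v$5 + u$5 * v$4"
  "cross7 u v $ 3 = u$4 * v$0 - u$0 * v$4 + u$5 * v$1 - u$1 * v$5 - u$6 * v$2 + u$2 * v$6"
  "cross7 u v $ 4 = u$0 * v$3 - u$3 * v$0 + u$1 * v$6 - u$6 * v$1 + u$2 * v$5 - u$5 * v$2"
  "cross7 u v $ 5 = u$6 * v$0 - u$0 * v$6 + u$1 * v$3 - u$3 * v$1 + u$4 * v$2 - u$2 * v$4"
  "cross7 u v $ 6 = u$0 * v$5 - u$5 * v$0 + u$4 * v$1 - u$1 * v$4 + u$3 * v$2 - u$2 * v$3"
  by (simp_all add: cross7_def phi7_expand axis_def)

text \<open>The defining relation of the cross product for arbitrary \<open>w\<close>; the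
  definition prescribes it on basis vectors.\<close>

lemma phi7_eq_inner: "phi7 u v w = cross7 u v \<bullet> w"
  by (simp add: phi7_expand inner_7 cross7_nth algebra_simps)

lemma bounded_bilinear_cross7: "bounded_bilinear cross7"
  unfolding bilinear_conv_bounded_bilinear[symmetric] bilinear_def
  by (intro conjI allI linearI)
     (simp_all add: vec_eq_iff forall_7 cross7_nth algebra_simps)

lemma cross7_orthogonal: "cross7 u v \<bullet> u = 0" "cross7 u v \<bullet> v = 0"
  by (simp_all add: inner_7 cross7_nth algebra_simps)

lemma cross7_norm_square: "cross7 u v \<bullet> cross7 u v = (u \<bullet> u) * (v \<bullet> v) - (u \<bullet> v)\<^sup>2"
  unfolding inner_7 cross7_nth power2_eq_square by (simp add: algebra_simps)

text \<open>The third vector is orthogonal to the first two, so with \<open>q\<close> its squared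
  norm the Gram determinant is \<open>((u \<bullet> u) * (v \<bullet> v) - (u \<bullet> v)^2) * q =
  q * q\<close>. Both sides are therefore \<open>q\<close>.\<close>

lemma phi7_eq_vol3:
  assumes "norm u = 1"
  shows "phi7 u v (cross7 u v) = vol3 u v (cross7 u v)"
proof -
  have "u \<bullet> u = 1" using assms by (simp add: norm_eq_1)
  define q where "q = cross7 u v \<bullet> cross7 u v"
  have q: "v \<bullet> v - (u \<bullet> v)\<^sup>2 = q" using \<open>u \<bullet> u = 1\<close> cross7_norm_square[of u v] by (simp add: q_def)
  have "vol3 u v (cross7 u v) = sqrt ((v \<bullet> v - (u \<bullet> v)\<^sup>2) * q)"
    using cross7_orthogonal[of u v] \<open>u \<bullet> u = 1\<close>
    by (simp add: vol3_def Let_def inner_commute q_def[symmetric] power2_eq_square algebra_simps)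
  also have "\<dots> = q" unfolding q by (simp add: q_def)
  finally show ?thesis by (simp add: phi7_eq_inner q_def)
qed

section \<open>The coupled system for the ruling and the base surface\<close>

definition coupled_cross7 :: "(real^7) \<times> (real^7) \<Rightarrow> (real^7) \<times> (real^7) \<Rightarrow> (real^7) \<times> (real^7)" where
  "coupled_cross7 p q = (cross7 (fst p) (fst q), cross7 (fst p) (snd q))"

lemma bounded_bilinear_coupled_cross7: "bounded_bilinear coupled_cross7"
proof -
  interpret cross7: bounded_bilinear cross7 by (rule bounded_bilinear_cross7)
  show ?thesis
    unfolding bilinear_conv_bounded_bilinear[symmetric] bilinear_def
    by (intro conjI allI linearI)
       (simp_all add: coupled_cross7_def cross7.add_left cross7.add_right cross7.scaleR_left cross7.scaleR_right)
qed

section \<open>Pairs of analytic functions and comparison with the given notions of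
  analyticity\<close>

lemma has_sum_Pair:
  fixes f :: "'i \<Rightarrow> 'a::real_normed_vector" and g :: "'i \<Rightarrow> 'b::real_normed_vector"
  assumes "(f has_sum x) A" "(g has_sum y) A"
  shows "((\<lambda>i. (f i, g i)) has_sum (x, y)) A"
proof -
  have "((\<lambda>i. (f i, 0) + (0, g i)) has_sum (x, 0) + (0, y)) A"
    by (intro has_sum_add has_sum_bounded_linear[OF _ assms(1)] has_sum_bounded_linear[OF _ assms(2)]
        bounded_linear_Pair bounded_linear_ident bounded_linear_zero)
  then show ?thesis by simp
qed

lemma power_series_on_Pair:
  assumes "power_series_on f x0 c r" "power_series_on g x0 d r"
  shows "power_series_on (\<lambda>x. (f x, g x)) x0 (\<lambda>n. (c n, d n)) r"
  using assms by (auto simp: power_series_on_def intro: has_sum_Pair)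

lemma analytic2_at_Pair_iff:
  "analytic2_at (\<lambda>s t. (f s t, g s t)) s0 t0 \<longleftrightarrow> analytic2_at f s0 t0 \<and> analytic2_at g s0 t0"
proof
  assume "analytic2_at (\<lambda>s t. (f s t, g s t)) s0 t0"
  then obtain c r where r: "0 < r" and c: "double_series_on (\<lambda>s t. (f s t, g s t)) s0 t0 c r"
    by (auto simp: analytic2_at_def)
  have "double_series_on f s0 t0 (\<lambda>m n. fst (c m n)) r" "double_series_on g s0 t0 (\<lambda>m n. snd (c m n)) r"
    using has_sum_bounded_linear[OF bounded_linear_fst double_series_onD[OF c]]
      has_sum_bounded_linear[OF bounded_linear_snd double_series_onD[OF c]]
    by (auto simp: double_series_on_def case_prod_unfold)
  with r show "analytic2_at f s0 t0 \<and> analytic2_at g s0 t0" by (auto simp: analytic2_at_def)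
next
  assume "analytic2_at f s0 t0 \<and> analytic2_at g s0 t0"
  then obtain c r d r' where r: "0 < r" "0 < r'"
    and c: "double_series_on f s0 t0 c r" and d: "double_series_on g s0 t0 d r'"
    by (auto simp: analytic2_at_def)
  have "double_series_on (\<lambda>s t. (f s t, g s t)) s0 t0 (\<lambda>m n. (c m n, d m n)) (min r r')"
    using has_sum_Pair[OF double_series_onD[OF c] double_series_onD[OF d]]
    by (simp add: double_series_on_def case_prod_unfold)
  with r show "analytic2_at (\<lambda>s t. (f s t, g s t)) s0 t0"
    unfolding analytic2_at_def
    by (intro exI[of _ "\<lambda>m n. (c m n, d m n)"] exI[of _ "min r r'"]) simp
qed

lemma real_analytic1_on_power_series:
  "real_analytic1_on f U \<Longrightarrow> s \<in> U \<Longrightarrow> \<exists>c r. 0 < r \<and> power_series_on f s c r"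
  unfolding real_analytic1_on_def power_series_on_iff_sums by blast

text \<open>The box of half-width \<open>r / 2\<close> lies in the disc of radius \<open>r\<close>,
  which lies in the box of half-width \<open>r\<close>.\<close>

lemma real_analytic2_on_iff: "real_analytic2_on F U \<longleftrightarrow> (\<forall>(s, t)\<in>U. analytic2_at F s t)"
proof -
  have "(\<exists>r>0. \<exists>c. \<forall>s t. dist (s, t) (s0, t0) < r \<longrightarrow>
      ((\<lambda>(m, n). ((s - s0) ^ m * (t - t0) ^ n) *\<^sub>R c m n) has_sum F s t) UNIV) \<longleftrightarrow> analytic2_at F s0 t0"
    (is "?L \<longleftrightarrow> ?R") for s0 t0
  proof
    assume ?L
    then obtain r c where r: "0 < r" and c: "\<And>s t. dist (s, t) (s0, t0) < r \<Longrightarrow>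
        ((\<lambda>(m, n). ((s - s0) ^ m * (t - t0) ^ n) *\<^sub>R c m n) has_sum F s t) UNIV" by blast
    have "double_series_on F s0 t0 c (r / 2)"
      unfolding double_series_on_def
    proof (intro allI impI c)
      fix s t assume "\<bar>s - s0\<bar> < r / 2" "\<bar>t - t0\<bar> < r / 2"
      then show "dist (s, t) (s0, t0) < r"
        using sqrt_sum_squares_le_sum_abs[of "s - s0" "t - t0"] by (simp add: dist_Pair_Pair dist_real_def)
    qed
    then show ?R using r unfolding analytic2_at_def by (metis half_gt_zero)
  next
    assume ?R
    then obtain r c where r: "0 < r" and c: "double_series_on F s0 t0 c r"
      by (auto simp: analytic2_at_def)
    have "\<bar>s - s0\<bar> < r \<and> \<bar>t - t0\<bar> < r" if "dist (s, t) (s0, t0) < r" for s t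
      using that dist_fst_le[of "(s, t)" "(s0, t0)"] dist_snd_le[of "(s, t)" "(s0, t0)"]
      by (simp add: dist_real_def)
    then show ?L using r double_series_onD[OF c] by blast
  qed
  then show ?thesis unfolding real_analytic2_on_def by (simp add: case_prod_unfold)
qed

text \<open>Analyticity makes both components differentiable, so that
  \<open>vector_derivative\<close> of the pair splits into the components' derivatives.\<close>

lemma coupled_equation_iff:
  assumes "analytic2_at (\<phi> :: real \<Rightarrow> real \<Rightarrow> real^7) s t" "analytic2_at (\<psi> :: real \<Rightarrow> real \<Rightarrow> real^7) s t"
  shows "vector_derivative (\<lambda>t. (\<phi> s t, \<psi> s t)) (at t) =
      coupled_cross7 (\<phi> s t, \<psi> s t) (vector_derivative (\<lambda>s'. (\<phi> s' t, \<psi> s' t)) (at s)) \<longleftrightarrow>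
    d_t \<phi> s t = cross7 (\<phi> s t) (d_s \<phi> s t) \<and> d_t \<psi> s t = cross7 (\<phi> s t) (d_s \<psi> s t)"
  using vector_derivative_at[OF has_vector_derivative_Pair[OF assms[THEN analytic2_at_has_derivative_fst]]]
    vector_derivative_at[OF has_vector_derivative_Pair[OF assms[THEN analytic2_at_has_derivative_snd]]]
  by (simp add: coupled_cross7_def d_s_def d_t_def)

text \<open>\<open>\<phi> \<times> \<phi>\<^sub>s\<close> is orthogonal to \<open>\<phi>\<close>, so the flow preserves \<open>\<bar>\<phi>\<bar>\<close>.\<close>

lemma norm_preserved:
  assumes an: "\<And>t. t \<in> {-\<epsilon><..<\<epsilon>} \<Longrightarrow> analytic2_at \<phi> s t"
    and eq: "\<And>t. t \<in> {-\<epsilon><..<\<epsilon>} \<Longrightarrow> d_t \<phi> s t = cross7 (\<phi> s t) (d_s \<phi> s t)"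
    and t: "t \<in> {-\<epsilon><..<\<epsilon>}"
  shows "norm (\<phi> s t) = norm (\<phi> s 0)"
proof -
  have "\<exists>c. \<forall>t\<in>{-\<epsilon><..<\<epsilon>}. \<phi> s t \<bullet> \<phi> s t = c"
  proof (rule has_field_derivative_zero_constant)
    fix t assume t: "t \<in> {-\<epsilon><..<\<epsilon>}"
    have "(\<phi> s has_vector_derivative d_t \<phi> s t) (at t)"
      using analytic2_at_has_derivative_snd[OF an[OF t]] by (simp add: d_t_def)
    from has_derivative_inner[OF this[unfolded has_vector_derivative_def] this[unfolded has_vector_derivative_def]]
    have "((\<lambda>t. \<phi> s t \<bullet> \<phi> s t) has_derivative (\<lambda>h. 0)) (at t)"
      using cross7_orthogonal[of "\<phi> s t" "d_s \<phi> s t"] unfolding eq[OF t] by (simp add: inner_commute)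
    then show "((\<lambda>t. \<phi> s t \<bullet> \<phi> s t) has_field_derivative 0) (at t within {-\<epsilon><..<\<epsilon>})"
      by (simp add: has_field_derivative_def has_derivative_at_withinI lambda_zero)
  qed simp
  moreover have "0 \<in> {-\<epsilon><..<\<epsilon>}" using t by auto
  ultimately show ?thesis using t by (metis norm_eq_sqrt_inner)
qed

text \<open>Linearity of the cross product in its second argument merges the two equations into
  \<open>F\<^sub>t = \<phi> \<times> F\<^sub>s\<close> for every \<open>r\<close>, which is the
  frame of \<open>phi7_eq_vol3\<close>.\<close>

lemma ruled_associative_solution:
  assumes an: "\<And>s t. (s, t) \<in> D \<Longrightarrow> analytic2_at \<phi> s t \<and> analytic2_at \<psi> s t"
    and norm: "\<And>s t. (s, t) \<in> D \<Longrightarrow> norm (\<phi> s t) = 1"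
    and eq: "\<And>s t. (s, t) \<in> D \<Longrightarrow>
      d_t \<phi> s t = cross7 (\<phi> s t) (d_s \<phi> s t) \<and> d_t \<psi> s t = cross7 (\<phi> s t) (d_s \<psi> s t)"
  shows "ruled_associative \<phi> \<psi> D"
proof -
  interpret cross7: bounded_bilinear cross7 by (rule bounded_bilinear_cross7)
  have "(\<lambda>s'. f s' t) differentiable (at s)" "(\<lambda>t'. f s t') differentiable (at t)" if "analytic2_at f s t"
    for f :: "real \<Rightarrow> real \<Rightarrow> real^7" and s t
    using analytic2_at_has_derivative_fst[OF that] analytic2_at_has_derivative_snd[OF that]
    by (auto intro: differentiableI_vector)
  moreover have "phi7 (\<phi> s t) (r *\<^sub>R d_s \<phi> s t + d_s \<psi> s t) (r *\<^sub>R d_t \<phi> s t + d_t \<psi> s t) =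
      vol3 (\<phi> s t) (r *\<^sub>R d_s \<phi> s t + d_s \<psi> s t) (r *\<^sub>R d_t \<phi> s t + d_t \<psi> s t)" if "(s, t) \<in> D" for r s t
  proof -
    have "r *\<^sub>R d_t \<phi> s t + d_t \<psi> s t = cross7 (\<phi> s t) (r *\<^sub>R d_s \<phi> s t + d_s \<psi> s t)"
      using eq[OF that] by (simp add: cross7.add_right cross7.scaleR_right)
    then show ?thesis using phi7_eq_vol3[OF norm[OF that]] by simp
  qed
  ultimately show ?thesis
    unfolding ruled_associative_def Let_def using an norm by (simp add: case_prod_unfold)
qed

theorem theorem6p5:
  fixes a b :: real
    and phi0 psi0 :: "real \<Rightarrow> real^7"
  assumes "a < b"
    and "\<exists>U. open U \<and> {a..b} \<subseteq> U \<and> real_analytic1_on phi0 U"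
    and "\<exists>U. open U \<and> {a..b} \<subseteq> U \<and> real_analytic1_on psi0 U"
    and "\<forall>s\<in>{a..b}. norm (phi0 s) = 1"
  shows "\<exists>\<epsilon>>0.
    (let D = {a..b} \<times> {-\<epsilon><..<\<epsilon>};
         sol = (\<lambda>phi psi.
            (\<exists>U. open U \<and> D \<subseteq> U \<and> real_analytic2_on phi U \<and> real_analytic2_on psi U)
          \<and> (\<forall>(s, t)\<in>D. norm (phi s t) = 1)
          \<and> (\<forall>s\<in>{a..b}. phi s 0 = phi0 s \<and> psi s 0 = psi0 s)
          \<and> (\<forall>(s, t)\<in>D. d_t phi s t = cross7 (phi s t) (d_s phi s t)
                        \<and> d_t psi s t = cross7 (phi s t) (d_s psi s t)))
     in \<exists>phi psi. sol phi psi
          \<and> (\<forall>phi' psi'. sol phi' psi' \<longrightarrow>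
               (\<forall>(s, t)\<in>D. phi' s t = phi s t \<and> psi' s t = psi s t))
          \<and> ruled_associative phi psi D)"
proof -
  note bb = bounded_bilinear_coupled_cross7
  define f where "f s = (phi0 s, psi0 s)" for s
  define w where "w = series_solution coupled_cross7 f"
  define \<phi> \<psi> where "\<phi> s t = fst (w s t)" and "\<psi> s t = snd (w s t)" for s t
  have w: "w = (\<lambda>s t. (\<phi> s t, \<psi> s t))" by (simp add: \<phi>_def \<psi>_def)
  have "\<exists>c r. 0 < r \<and> power_series_on f s c r" if "s \<in> {a..b}" for s
  proof -
    obtain c r where "0 < r" "power_series_on phi0 s c r"
      using assms(2) real_analytic1_on_power_series \<open>s \<in> {a..b}\<close> by blast
    moreover obtain d r' where "0 < r'" "power_series_on psi0 s d r'"
      using assms(3) real_analytic1_on_power_series \<open>s \<in> {a..b}\<close> by blast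
    ultimately have "power_series_on f s (\<lambda>n. (c n, d n)) (min r r')" "0 < min r r'"
      unfolding f_def by (auto intro!: power_series_on_Pair elim: power_series_on_mono)
    then show ?thesis by blast
  qed
  from series_solution_exists[OF bb this]
  obtain \<epsilon> U where "0 < \<epsilon>" and U: "open U" "{a..b} \<times> {-\<epsilon><..<\<epsilon>} \<subseteq> U"
    and wU: "\<forall>(s, t)\<in>U. analytic2_at w s t \<and>
      vector_derivative (w s) (at t) = coupled_cross7 (w s t) (vector_derivative (\<lambda>s'. w s' t) (at s))"
    unfolding w_def by blast
  define D where "D = {a..b} \<times> {-\<epsilon><..<\<epsilon>}"
  define sol where "sol = (\<lambda>phi psi.
            (\<exists>U. open U \<and> D \<subseteq> U \<and> real_analytic2_on phi U \<and> real_analytic2_on psi U)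
          \<and> (\<forall>(s, t)\<in>D. norm (phi s t) = 1)
          \<and> (\<forall>s\<in>{a..b}. phi s 0 = phi0 s \<and> psi s 0 = psi0 s)
          \<and> (\<forall>(s, t)\<in>D. d_t phi s t = cross7 (phi s t) (d_s phi s t)
                        \<and> d_t psi s t = cross7 (phi s t) (d_s psi s t)))"
  have DU: "(s, t) \<in> U" if "(s, t) \<in> D" for s t
    using U(2) that unfolding D_def by blast
  have an: "analytic2_at \<phi> s t" "analytic2_at \<psi> s t" if "(s, t) \<in> U" for s t
    using wU that unfolding w by (auto simp: analytic2_at_Pair_iff)
  have eq: "d_t \<phi> s t = cross7 (\<phi> s t) (d_s \<phi> s t)" "d_t \<psi> s t = cross7 (\<phi> s t) (d_s \<psi> s t)"
    if "(s, t) \<in> U" for s t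
    using coupled_equation_iff[OF an[OF that]] wU that unfolding w by auto
  have init: "\<phi> s 0 = phi0 s" "\<psi> s 0 = psi0 s" for s
    by (simp_all add: \<phi>_def \<psi>_def w_def f_def)
  have norm: "norm (\<phi> s t) = 1" if "(s, t) \<in> D" for s t
  proof -
    have "norm (\<phi> s t) = norm (\<phi> s 0)"
      by (rule norm_preserved[where \<epsilon> = \<epsilon>, OF an(1)[OF DU] eq(1)[OF DU]]) (use that in \<open>auto simp: D_def\<close>)
    then show ?thesis using init assms(4) that by (simp add: D_def)
  qed
  have "real_analytic2_on \<phi> U" "real_analytic2_on \<psi> U"
    using an by (auto simp: real_analytic2_on_iff)
  then have "sol \<phi> \<psi>"
    unfolding sol_def using U norm init eq by (auto simp: D_def)
  moreover have "phi' s t = \<phi> s t \<and> psi' s t = \<psi> s t" if sol': "sol phi' psi'" and "(s, t) \<in> D" for phi' psi' s t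
  proof -
    \<comment> \<open>A competitor is analytic on an open set around \<open>D\<close>, so its
      two-sided \<open>s\<close>-derivatives exist at \<open>a\<close> and \<open>b\<close> as
      well.\<close>
    have an': "analytic2_at phi' s t" "analytic2_at psi' s t" if "(s, t) \<in> D" for s t
      using sol' that unfolding sol_def real_analytic2_on_iff by blast+
    have eq': "vector_derivative (\<lambda>t. (phi' s t, psi' s t)) (at t) = coupled_cross7 (phi' s t, psi' s t)
        (vector_derivative (\<lambda>s'. (phi' s' t, psi' s' t)) (at s))" if "(s, t) \<in> D" for s t
      using sol' that unfolding coupled_equation_iff[OF an'[OF that]] sol_def by blast
    have init': "(phi' s 0, psi' s 0) = f s" if "s \<in> {a..b}" for s
      using sol' that unfolding sol_def f_def by auto
    have wD: "analytic2_at w s t"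
      "vector_derivative (w s) (at t) = coupled_cross7 (w s t) (vector_derivative (\<lambda>s'. w s' t) (at s))"
      "w s 0 = f s" if "(s, t) \<in> D" for s t
      using wU DU[OF that] by (auto simp: w_def)
    have "(phi' s t, psi' s t) = w s t"
      \<comment> \<open>Once paired, the competitor solves the same initial value problem as
        \<open>w\<close> on the same strip.\<close>
      by (rule analytic_solution_unique[OF bb \<open>a < b\<close> \<open>0 < \<epsilon>\<close>, where f = f and F = "\<lambda>s t. (phi' s t, psi' s t)"])
         (use an' eq' init' wD \<open>(s, t) \<in> D\<close> in \<open>auto simp: D_def f_def analytic2_at_Pair_iff\<close>)
    then show ?thesis unfolding w by simp
  qed
  moreover have "ruled_associative \<phi> \<psi> D"
    by (rule ruled_associative_solution) (use an eq norm DU in auto)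
  ultimately have *: "\<exists>phi psi. sol phi psi
          \<and> (\<forall>phi' psi'. sol phi' psi' \<longrightarrow> (\<forall>(s, t)\<in>D. phi' s t = phi s t \<and> psi' s t = psi s t))
          \<and> ruled_associative phi psi D"
    by blast
  show ?thesis
    unfolding Let_def by (rule exI, rule conjI[OF \<open>0 < \<epsilon>\<close>], rule *[unfolded sol_def D_def])
qed

end
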